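(* Let $0<\alpha<n-k-q$ and let $f$ be a function on $G(n,j)$. Then $$(R_{p,q}^k I_{n-j}^\alpha f)(\eta,v)=(I_{n-k}^\alpha R_{p,q}^k f)(\eta,v),\qquad (\eta,v)\in G(n,k),$$ provided that either side of this equality exists in the Lebesgue sense.
   Context: Standing assumptions: $n,p,q,l$ are integers with $p>0$, $q>0$, $l>0$, $p+q+l<n$; set $j=p+q$ and $k=p+l$. For a linear subspace $X\subset\mathbb{R}^n$, $G_m(X)$ is the set of $m$-dimensional linear subspaces of $X$ with its rotation-invariant probability measure; $G_{n,m}=G_m(\mathbb{R}^n)$. $G(n,m)$ is the set of all affine $m$-planes in $\mathbb{R}^n$; each element is written $(\xi,u)=\xi+u$ with $\xi\in G_{n,m}$, $u\in\xi^\perp$. For mutually orthogonal subspaces $P,Q$, $[P,Q]=P\oplus Q$. The Strichartz transform of a function $f$ on $G(n,j)$ is the function on $G(n,k)$ $$(R_{p,q}^k f)(\eta,v)=\int_{G_q(\eta^\perp)}dQ\int_{G_p(\eta)}dP\int_{P^\perp\cap\eta} f([P,Q]+u+v)\,du,$$ with $dQ,dP$ the invariant probability measures. For $m\in\{j,k\}$, $I_{n-m}^\alpha$ is the Riesz potential on the $(n-m)$-dimensional fibers of $G(n,m)$: $$(I_{n-m}^\alpha\varphi)(\xi,u)=\frac{1}{\gamma_{n-m}(\alpha)}\int_{\xi^\perp}\frac{\varphi(\xi,w)}{|u-w|^{n-m-\alpha}}\,dw,\qquad \gamma_{d}(\alpha)=\frac{2^\alpha\pi^{d/2}\Gamma(\alpha/2)}{\Gamma((d-\alpha)/2)}.$$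 "Exists in the Lebesgue sense" means that the (iterated) integral converges absolutely, i.e. it is finite with the function replaced by its absolute value. *)

theory Defs
  imports "HOL-Analysis.Analysis" "HOL-Probability.Probability_Measure"
begin

section \<open>Linear Grassmannians\<close>

definition grassmannian :: "nat \<Rightarrow> (real ^ 'n) set \<Rightarrow> (real ^ 'n) set set" where
  "grassmannian m X = {P. subspace P \<and> P \<subseteq> X \<and> dim P = m}"

text \<open>
  On a subspace P the map \<^term>\<open>closest_point P\<close> is the orthogonal projection onto P.  The
  Grassmannian carries the topology it inherits from its embedding into the space of matrices,
  sending P to the matrix of this projection; the following are its Borel sets.
\<close>

definition grassmannian_borel :: "nat \<Rightarrow> (real ^ 'n) set \<Rightarrow> (real ^ 'n) set measure" where
  "grassmannian_borel m X =
     vimage_algebra (grassmannian m X) (\<lambda>P. matrix (closest_point P)) borel"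

definition invariant_prob_on_grassmannian ::
    "nat \<Rightarrow> (real ^ 'n) set \<Rightarrow> (real ^ 'n) set measure \<Rightarrow> bool" where
  "invariant_prob_on_grassmannian m X M \<longleftrightarrow>
     prob_space M \<and> sets M = sets (grassmannian_borel m X) \<and>
     (\<forall>g. orthogonal_transformation g \<and> g ` X = X \<longrightarrow> distr M M (\<lambda>P. g ` P) = M)"

text \<open>
  For a subspace X with m at most its dimension there is exactly one such measure, since the
  orthogonal group of X is compact and acts transitively on the m-dimensional subspaces of X;
  so the choice operator picks out that measure.
\<close>

definition grassmannian_measure :: "nat \<Rightarrow> (real ^ 'n) set \<Rightarrow> (real ^ 'n) set measure" where
  "grassmannian_measure m X = (SOME M. invariant_prob_on_grassmannian m X M)"


section \<open>Lebesgue measure on a linear subspace\<close>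

text \<open>
  This imitates the definition of \<^const>\<open>lborel\<close>, with an orthonormal basis of the subspace in
  place of the standard basis; the result does not depend on that basis.  It is a measure on the
  Borel sets of the whole space that is concentrated on the subspace.
\<close>

definition orthonormal_basis_of :: "(real ^ 'n) set \<Rightarrow> (real ^ 'n) set \<Rightarrow> bool" where
  "orthonormal_basis_of X B \<longleftrightarrow>
     pairwise orthogonal B \<and> (\<forall>b\<in>B. norm b = 1) \<and> span B = X"

definition subspace_lborel :: "(real ^ 'n) set \<Rightarrow> (real ^ 'n) measure" where
  "subspace_lborel X =
     (let B = (SOME B. orthonormal_basis_of X B)
      in distr (\<Pi>\<^sub>M b\<in>B. lborel) borel (\<lambda>c. \<Sum>b\<in>B. c b *\<^sub>R b))"


section \<open>Affine Grassmannians\<close>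

definition affine_grassmannian :: "nat \<Rightarrow> (real ^ 'n) set set" where
  "affine_grassmannian m = {A. affine A \<and> A \<noteq> {} \<and> aff_dim A = int m}"

text \<open>
  The two components of a plane written as the translate of a linear subspace by a vector
  orthogonal to it.
\<close>

definition plane_dir :: "(real ^ 'n) set \<Rightarrow> (real ^ 'n) set" where
  "plane_dir A = {x - y | x y. x \<in> A \<and> y \<in> A}"

definition plane_foot :: "(real ^ 'n) set \<Rightarrow> real ^ 'n" where
  "plane_foot A = (THE u. u \<in> A \<and> u \<in> (plane_dir A)\<^sup>\<bottom>)"

text \<open>
  Borel sets of the affine Grassmannian, viewed as a vector bundle over the linear one.
\<close>

definition affine_grassmannian_borel :: "nat \<Rightarrow> (real ^ 'n) set measure" where
  "affine_grassmannian_borel m =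
     vimage_algebra (affine_grassmannian m)
       (\<lambda>A. (matrix (closest_point (plane_dir A)), plane_foot A)) borel"


section \<open>Riesz potentials and the Strichartz transform\<close>

definition riesz_gamma :: "nat \<Rightarrow> real \<Rightarrow> real" where
  "riesz_gamma d \<alpha> =
     2 powr \<alpha> * pi powr (real d / 2) * Gamma (\<alpha> / 2) / Gamma ((real d - \<alpha>) / 2)"

text \<open>
  Functions on planes take the plane itself, as a set of points, as argument.  The parameter d is
  the codimension of the planes.  At the single point w = u the kernel has the junk value 0.
\<close>

definition riesz_potential ::
    "nat \<Rightarrow> real \<Rightarrow> ((real ^ 'n) set \<Rightarrow> 'b::{banach, second_countable_topology})
      \<Rightarrow> (real ^ 'n) set \<Rightarrow> 'b" where
  "riesz_potential d \<alpha> \<phi> A =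
     (let \<xi> = plane_dir A; u = plane_foot A
      in (1 / riesz_gamma d \<alpha>) *\<^sub>R
         (LINT w|subspace_lborel (\<xi>\<^sup>\<bottom>). (1 / norm (u - w) powr (real d - \<alpha>)) *\<^sub>R \<phi> ((+) w ` \<xi>)))"

definition strichartz_transform ::
    "nat \<Rightarrow> nat \<Rightarrow> ((real ^ 'n) set \<Rightarrow> 'b::{banach, second_countable_topology})
      \<Rightarrow> (real ^ 'n) set \<Rightarrow> 'b" where
  "strichartz_transform p q f A =
     (let \<eta> = plane_dir A; v = plane_foot A
      in LINT Q|grassmannian_measure q (\<eta>\<^sup>\<bottom>). LINT P|grassmannian_measure p \<eta>.
           LINT u|subspace_lborel (P\<^sup>\<bottom> \<inter> \<eta>). f ((+) (u + v) ` (P + Q)))"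

text \<open>
  The same two operators on nonnegative extended-real functions.  They express absolute
  convergence of the iterated integrals, which the Bochner integrals above do not record.
\<close>

definition riesz_potential_nn ::
    "nat \<Rightarrow> real \<Rightarrow> ((real ^ 'n) set \<Rightarrow> ennreal) \<Rightarrow> (real ^ 'n) set \<Rightarrow> ennreal" where
  "riesz_potential_nn d \<alpha> \<phi> A =
     (let \<xi> = plane_dir A; u = plane_foot A
      in ennreal (1 / riesz_gamma d \<alpha>) *
         (\<integral>\<^sup>+ w. ennreal (1 / norm (u - w) powr (real d - \<alpha>)) * \<phi> ((+) w ` \<xi>)
            \<partial>subspace_lborel (\<xi>\<^sup>\<bottom>)))"

definition strichartz_transform_nn ::
    "nat \<Rightarrow> nat \<Rightarrow> ((real ^ 'n) set \<Rightarrow> ennreal) \<Rightarrow> (real ^ 'n) set \<Rightarrow> ennreal" where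
  "strichartz_transform_nn p q f A =
     (let \<eta> = plane_dir A; v = plane_foot A
      in \<integral>\<^sup>+ Q. \<integral>\<^sup>+ P. \<integral>\<^sup>+ u. f ((+) (u + v) ` (P + Q))
           \<partial>subspace_lborel (P\<^sup>\<bottom> \<inter> \<eta>) \<partial>grassmannian_measure p \<eta>
           \<partial>grassmannian_measure q (\<eta>\<^sup>\<bottom>))"

end

theory Submission
  imports Defs "HOL-Probability.Distributions"
begin

text \<open>
  Fix the direction \<eta> of the k-plane and the two summands P and Q of the direction of the j-plane.
Then \<^term>\<open>R = Q\<^sup>\<bottom> \<inter> \<eta>\<^sup>\<bottom>\<close> has dimension m = n - k - q and is orthogonal to both
\<^term>\<open>A = P\<^sup>\<bottom> \<inter> \<eta>\<close> (dimension l) and Q.  The potential on j-planes is an integral over the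
orthogonal sum A + R of dimension l + m, and the potential on k-planes is an integral over Q + R of
dimension q + m.  The Strichartz transform integrates the former over A, and in the latter the plane
w + P + Q does not change when w moves along Q.  So on either side the Riesz kernel is integrated out
over a subspace orthogonal to R, and such an integration turns the Riesz kernel of dimension d + m into
the Riesz kernel of dimension m, with exactly the normalising constants of the potentials
(\<open>nn_integral_riesz_kernel_subspace\<close>; this needs \<alpha> < m).  Both sides become the integral over
b in R of the m-dimensional kernel at proj_R(v) - b times the integral of f over the planes
a + b + P + Q with a in A (\<open>riesz_kernel_identity\<close>).

  What remains is Fubini's theorem, and the obstacle is that P and Q are variables of integration while
the inner integrals are over subspaces that depend on them.  It is removed by a Gaussian weight: since
exp(-pi |y|^2) has integral 1 over a Euclidean space of any dimension, the integral of h over a subspace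
X equals the integral over the whole space of h(proj_X x) exp(-pi |x - proj_X x|^2)
(\<open>nn_integral_subspace_lborel\<close>).  This also shows that Lebesgue measure on X does not depend on the
orthonormal basis, and it reduces joint measurability to that of orthogonal projections, which is what
the Borel structure of the Grassmannian provides.

  Either side is then the integral of f with respect to a measure on triples (Q, P, z), where z is a
point of the plane z + P + Q.  The identity for fixed directions and Tonelli's theorem show that the
two measures are equal (\<open>incidence_measure_eq\<close>), so absolute convergence and the value of the
integral agree on the two sides.

  Fubini's theorem also requires that the measures on the Grassmannians are probability measures on the
Borel sets.  As each is chosen among the invariant probability measures, it has to be shown that such a
measure exists; it is built by adding one Gaussian random direction at a time
(\<open>invariant_prob_on_grassmannian_exists\<close>).
\<close>

section \<open>Orthogonal projections\<close>

abbreviation proj :: "(real ^ 'n) set \<Rightarrow> real ^ 'n \<Rightarrow> real ^ 'n" where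
  "proj \<equiv> closest_point"

text \<open>
  The nearest point of a subspace is characterised by the orthogonality of the residual, by Pythagoras;
everything below uses \<^const>\<open>closest_point\<close> through this characterisation.
\<close>

lemma orthogonal_decomposition_iff_proj:
  fixes X :: "(real ^ 'n) set"
  assumes "subspace X"
  shows "z \<in> X \<and> (\<forall>y\<in>X. (x - z) \<bullet> y = 0) \<longleftrightarrow> z = proj X x"
proof -
  have X: "convex X" "closed X" "X \<noteq> {}"
    using assms subspace_imp_convex closed_subspace subspace_0 by blast+
  have *: "z \<in> X \<and> (\<forall>y\<in>X. (x - z) \<bullet> y = 0) \<Longrightarrow> z = proj X x" for z
  proof (rule closest_point_unique)
    assume z: "z \<in> X \<and> (\<forall>y\<in>X. (x - z) \<bullet> y = 0)"
    show "\<forall>y\<in>X. dist x z \<le> dist x y"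
    proof
      fix y assume "y \<in> X"
      then have "(x - z) \<bullet> (z - y) = 0"
        using z assms by (simp add: subspace_diff)
      then have "(norm ((x - z) + (z - y)))\<^sup>2 = (norm (x - z))\<^sup>2 + (norm (z - y))\<^sup>2"
        by (intro norm_add_Pythagorean) (simp add: orthogonal_def)
      then have "(norm (x - z))\<^sup>2 \<le> (norm (x - y))\<^sup>2"
        by simp
      then show "dist x z \<le> dist x y"
        by (simp add: dist_norm power2_le_iff_abs_le)
    qed
  qed (use X in auto)
  have span: "span X = X"
    using assms by (simp add: span_eq_iff)
  obtain y y' where "y \<in> X" "\<And>w. w \<in> X \<Longrightarrow> orthogonal y' w" "x = y + y'"
    using orthogonal_subspace_decomp_exists[of X x, unfolded span] by metis
  then have "y \<in> X \<and> (\<forall>w\<in>X. (x - y) \<bullet> w = 0)"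
    by (auto simp: orthogonal_def)
  with *[of y] *[of z] show ?thesis by metis
qed

lemma
  assumes "subspace X"
  shows proj_in: "proj X x \<in> X"
    and proj_orth: "y \<in> X \<Longrightarrow> (x - proj X x) \<bullet> y = 0"
  using orthogonal_decomposition_iff_proj[OF assms, of "proj X x" x] by auto

lemma proj_eqI:
  assumes "subspace X" "z \<in> X" "\<And>y. y \<in> X \<Longrightarrow> (x - z) \<bullet> y = 0"
  shows "proj X x = z"
  using orthogonal_decomposition_iff_proj[OF assms(1), of z x] assms by auto

lemma linear_proj:
  assumes "subspace X"
  shows "linear (proj X)"
proof (rule linearI)
  note p = proj_in[OF assms] proj_orth[OF assms]
  show "proj X (x + y) = proj X x + proj X y" for x y
    using p[of x] p[of y] p(2)[of _ x] p(2)[of _ y]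
    by (intro proj_eqI assms) (auto simp: subspace_add assms algebra_simps inner_simps)
  show "proj X (c *\<^sub>R x) = c *\<^sub>R proj X x" for c x
    using p(1)[of x] p(2)[of _ x]
    by (intro proj_eqI assms) (auto simp: subspace_scale assms scaleR_diff_right[symmetric])
qed

lemma matrix_proj: "subspace X \<Longrightarrow> matrix (proj X) *v x = proj X x"
  by (simp add: matrix_works linear_proj)

lemma proj_self: "subspace X \<Longrightarrow> x \<in> X \<Longrightarrow> proj X x = x"
  by (intro proj_eqI) auto

lemma proj_eq_0: "subspace X \<Longrightarrow> (\<And>y. y \<in> X \<Longrightarrow> x \<bullet> y = 0) \<Longrightarrow> proj X x = 0"
  by (intro proj_eqI) (auto simp: subspace_0)

lemma measurable_proj:
  assumes "subspace (X :: (real ^ 'n) set)"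
  shows "proj X \<in> borel_measurable borel"
  by (intro borel_measurable_continuous_onI linear_continuous_on linear_conv_bounded_linear[THEN iffD1]
      linear_proj assms)

lemma orth_comp_iff: "x \<in> X\<^sup>\<bottom> \<longleftrightarrow> (\<forall>y\<in>X. x \<bullet> y = 0)"
  by (auto simp: orthogonal_comp_def orthogonal_def inner_commute)

lemma
  assumes "subspace X" "subspace Y" "Y \<subseteq> X\<^sup>\<bottom>"
  shows subspace_plus: "subspace (X + Y)"
    and proj_plus: "proj (X + Y) x = proj X x + proj Y x"
    and dim_plus: "dim (X + Y) = dim X + dim Y"
proof -
  have orth: "x \<bullet> y = 0" if "x \<in> X" "y \<in> Y" for x y
    using that assms(3) by (auto simp: orth_comp_iff inner_commute)
  have XY: "X + Y = {x + y | x y. x \<in> X \<and> y \<in> Y}"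
    by (auto simp: set_plus_def)
  show sub: "subspace (X + Y)"
    unfolding XY using subspace_sums[OF assms(1,2)] .
  have *: "proj Y x \<bullet> a = 0" "proj X x \<bullet> b = 0" if "a \<in> X" "b \<in> Y" for a b
    using orth[OF that(1) proj_in[OF assms(2)]] orth[OF proj_in[OF assms(1)] that(2)]
    by (auto simp: inner_commute)
  show "proj (X + Y) x = proj X x + proj Y x"
  proof (rule proj_eqI[OF sub])
    show "proj X x + proj Y x \<in> X + Y"
      using proj_in[OF assms(1)] proj_in[OF assms(2)] by (meson set_plus_intro)
    fix y assume "y \<in> X + Y"
    then obtain a b where ab: "a \<in> X" "b \<in> Y" "y = a + b" by (auto simp: set_plus_def)
    then show "(x - (proj X x + proj Y x)) \<bullet> y = 0"
      using proj_orth[OF assms(1) ab(1), of x] proj_orth[OF assms(2) ab(2), of x] *[OF ab(1,2)]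
      by (simp add: inner_simps)
  qed
  have "span (X \<union> Y) = X + Y"
    using assms(1,2) by (simp add: span_Un span_eq_iff[THEN iffD2] XY)
  then show "dim (X + Y) = dim X + dim Y"
    using dim_orthogonal_sum[of X Y] orth by (metis dim_span)
qed

lemma proj_orth_comp:
  assumes "subspace X"
  shows "proj (X\<^sup>\<bottom>) x = x - proj X x"
  using proj_in[OF assms] proj_orth[OF assms]
  by (intro proj_eqI subspace_orthogonal_comp) (auto simp: orth_comp_iff inner_commute)

lemma
  assumes "subspace X" "subspace Y" "X \<subseteq> Y"
  shows proj_orth_comp_Int: "proj (X\<^sup>\<bottom> \<inter> Y) x = proj Y x - proj X x"
    and dim_orth_comp_Int: "dim (X\<^sup>\<bottom> \<inter> Y) + dim X = dim Y"
proof -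
  show "proj (X\<^sup>\<bottom> \<inter> Y) x = proj Y x - proj X x"
  proof (rule proj_eqI)
    show "subspace (X\<^sup>\<bottom> \<inter> Y)"
      by (simp add: subspace_inter subspace_orthogonal_comp assms)
    show "proj Y x - proj X x \<in> X\<^sup>\<bottom> \<inter> Y"
    proof -
      have "proj Y x - proj X x \<in> Y"
        using assms proj_in by (meson subset_iff subspace_diff)
      moreover have "(proj Y x - proj X x) \<bullet> y = 0" if "y \<in> X" for y
        using proj_orth[OF assms(1) that, of x] proj_orth[OF assms(2), of y x] that assms(3)
        by (auto simp: inner_simps)
      ultimately show ?thesis by (auto simp: orth_comp_iff)
    qed
    fix y assume y: "y \<in> X\<^sup>\<bottom> \<inter> Y"
    then have "proj X x \<bullet> y = 0"
      using proj_in[OF assms(1), of x] by (auto simp: orth_comp_iff inner_commute)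
    then show "(x - (proj Y x - proj X x)) \<bullet> y = 0"
      using proj_orth[OF assms(2), of y x] y by (simp add: inner_simps)
  qed
  have "X\<^sup>\<bottom> \<inter> Y = {y \<in> Y. \<forall>x\<in>X. orthogonal x y}"
    by (auto simp: orthogonal_comp_def)
  then show "dim (X\<^sup>\<bottom> \<inter> Y) + dim X = dim Y"
    using dim_subspace_orthogonal_to_vectors[OF assms] by simp
qed

lemma proj_orthogonal_image:
  assumes "subspace X" "orthogonal_transformation g"
  shows "proj (g ` X) (g x) = g (proj X x)"
proof -
  have lin: "linear g" and inn: "g a \<bullet> g b = a \<bullet> b" for a b
    using assms by (auto simp: orthogonal_transformation_def)
  show ?thesis
    using proj_in[OF assms(1)] proj_orth[OF assms(1)]
    by (intro proj_eqI linear_subspace_image[OF lin assms(1)])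
       (auto simp: inn linear_diff[OF lin, symmetric])
qed

section \<open>Lebesgue measure on subspaces\<close>

lemma nn_integral_lborel_translation:
  fixes h :: "'a::euclidean_space \<Rightarrow> ennreal"
  assumes [measurable]: "h \<in> borel_measurable borel"
  shows "(\<integral>\<^sup>+x. h (a + x) \<partial>lborel) = (\<integral>\<^sup>+x. h x \<partial>lborel)"
  by (subst (2) lborel_distr_plus[of a, symmetric]) (simp add: nn_integral_distr)

lemma measurable_orthogonal_transformation:
  fixes g :: "'a::euclidean_space \<Rightarrow> 'a"
  shows "orthogonal_transformation g \<Longrightarrow> g \<in> borel_measurable borel"
  by (intro borel_measurable_continuous_onI linear_continuous_on linear_conv_bounded_linear[THEN iffD1]
      orthogonal_transformation_linear)

text \<open>
  The image of Lebesgue measure under an isometry is again translation invariant, and it gives the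
  unit ball the same mass; the usual double integral that proves uniqueness of Haar measure then
  identifies the two.
\<close>

lemma distr_lborel_orthogonal_transformation:
  fixes g :: "'a::euclidean_space \<Rightarrow> 'a"
  assumes g: "orthogonal_transformation g"
  shows "distr lborel borel g = lborel"
proof (rule measure_eqI)
  note [measurable] = measurable_orthogonal_transformation[OF g]
  have lin: "linear g" and "surj g"
    using g orthogonal_transformation_linear orthogonal_transformation_surj by auto
  define h where "h = inv g"
  have gh: "g (h y) = y" for y
    using \<open>surj g\<close> by (simp add: h_def surj_f_inv_f)
  let ?E = "ball 0 1 :: 'a set"
  fix A :: "'a set" assume "A \<in> sets (distr lborel borel g)"
  then have [measurable]: "A \<in> sets borel" by simp
  have [measurable]: "?E \<in> sets borel" by simp
  \<comment> \<open>Evaluate the product of the mass of A under the image measure and of E under Lebesgue measure; the translations by y and by g x interchange the roles of A and E.\<close>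
  have "emeasure (distr lborel borel g) A * emeasure lborel ?E
      = (\<integral>\<^sup>+y. (\<integral>\<^sup>+x. indicator A (g x) * indicator ?E y \<partial>lborel) \<partial>lborel)"
  proof -
    have "emeasure (distr lborel borel g) A = (\<integral>\<^sup>+x. indicator A (g x) \<partial>lborel)"
      by (subst nn_integral_distr[of g lborel borel "indicator A", symmetric]) auto
    then show ?thesis
      by (simp add: nn_integral_multc nn_integral_cmult_indicator)
  qed
  also have "\<dots> = (\<integral>\<^sup>+y. (\<integral>\<^sup>+x. indicator A (g x + y) * indicator ?E y \<partial>lborel) \<partial>lborel)"
  proof (rule nn_integral_cong)
    fix y
    have "(\<integral>\<^sup>+x. indicator A (g x + y) * indicator ?E y \<partial>lborel)
        = (\<integral>\<^sup>+x. indicator A (g (h y + x)) * indicator ?E y \<partial>lborel)"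
      by (simp add: linear_add[OF lin] gh add.commute)
    also have "\<dots> = (\<integral>\<^sup>+x. indicator A (g x) * indicator ?E y \<partial>lborel)"
      by (rule nn_integral_lborel_translation) measurable
    finally show "(\<integral>\<^sup>+x. indicator A (g x) * indicator ?E y \<partial>lborel)
        = (\<integral>\<^sup>+x. indicator A (g x + y) * indicator ?E y \<partial>lborel)" ..
  qed
  also have "\<dots> = (\<integral>\<^sup>+x. (\<integral>\<^sup>+y. indicator A (g x + y) * indicator ?E y \<partial>lborel) \<partial>lborel)"
    by (rule lborel_pair.Fubini') measurable
  also have "\<dots> = (\<integral>\<^sup>+x. (\<integral>\<^sup>+y. indicator A y * indicator ?E (y - g x) \<partial>lborel) \<partial>lborel)"
  proof (rule nn_integral_cong)
    fix x
    have "(\<integral>\<^sup>+y. indicator A (g x + y) * indicator ?E y \<partial>lborel)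
        = (\<integral>\<^sup>+y. indicator A (g x + y) * indicator ?E ((g x + y) - g x) \<partial>lborel)"
      by simp
    also have "\<dots> = (\<integral>\<^sup>+y. indicator A y * indicator ?E (y - g x) \<partial>lborel)"
      by (rule nn_integral_lborel_translation) measurable
    finally show "(\<integral>\<^sup>+y. indicator A (g x + y) * indicator ?E y \<partial>lborel)
        = (\<integral>\<^sup>+y. indicator A y * indicator ?E (y - g x) \<partial>lborel)" .
  qed
  also have "\<dots> = (\<integral>\<^sup>+y. (\<integral>\<^sup>+x. indicator A y * indicator ?E (y - g x) \<partial>lborel) \<partial>lborel)"
    by (rule lborel_pair.Fubini') measurable
  also have "\<dots> = (\<integral>\<^sup>+y. indicator A y * emeasure lborel ?E \<partial>lborel)"
  proof (rule nn_integral_cong)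
    fix y
    have "norm (y - g x) = norm (x - h y)" for x
      using orthogonal_transformation_norm[OF g, of "h y - x"]
      by (simp add: linear_diff[OF lin] gh norm_minus_commute)
    then have "(\<integral>\<^sup>+x. indicator ?E (y - g x) \<partial>lborel)
        = (\<integral>\<^sup>+x. (indicator ?E (x - h y) :: ennreal) \<partial>lborel)"
      by (intro nn_integral_cong) (simp add: indicator_def)
    also have "\<dots> = (\<integral>\<^sup>+x. indicator ?E x \<partial>lborel)"
      using nn_integral_lborel_translation[of "indicator ?E" "- h y"] by simp
    finally show "(\<integral>\<^sup>+x. indicator A y * indicator ?E (y - g x) \<partial>lborel)
        = indicator A y * emeasure lborel ?E"
      by (simp add: nn_integral_cmult)
  qed
  also have "\<dots> = emeasure lborel A * emeasure lborel ?E"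
    by (simp add: nn_integral_multc)
  finally have *: "emeasure (distr lborel borel g) A * emeasure lborel ?E
      = emeasure lborel A * emeasure lborel ?E" .
  have "emeasure lborel ?E \<noteq> 0" "emeasure lborel ?E \<noteq> \<infinity>"
    using unit_ball_vol_pos[of "real DIM('a)"] by (auto simp: emeasure_ball simp del: unit_ball_vol_pos)
  then show "emeasure (distr lborel borel g) A = emeasure lborel A"
    using * by (auto simp: ennreal_mult_cancel_left mult.commute[of _ "emeasure lborel ?E"])
qed simp

interpretation lborel_family: product_sigma_finite "\<lambda>_. lborel :: real measure"
  by standard

lemma measurable_coordinate_combination:
  fixes r :: "'b \<Rightarrow> 'a" and s :: "'b \<Rightarrow> real ^ 'n"
  assumes "\<And>b. b \<in> I \<Longrightarrow> r b \<in> B"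
  shows "(\<lambda>c. \<Sum>b\<in>I. c (r b) *\<^sub>R s b) \<in> borel_measurable (\<Pi>\<^sub>M b\<in>B. lborel)"
proof (intro borel_measurable_sum borel_measurable_scaleR borel_measurable_const)
  fix b assume "b \<in> I"
  then have "(\<lambda>c. c (r b)) \<in> measurable (\<Pi>\<^sub>M b\<in>B. lborel :: real measure) lborel"
    using assms by (intro measurable_component_singleton)
  then show "(\<lambda>c. c (r b)) \<in> borel_measurable (\<Pi>\<^sub>M b\<in>B. lborel :: real measure)"
    by simp
qed

lemma measurable_basis_combination[measurable]:
  fixes B :: "(real ^ 'n) set"
  shows
  "(\<lambda>c. \<Sum>b\<in>B. c b *\<^sub>R b) \<in> borel_measurable (\<Pi>\<^sub>M b\<in>B. lborel)"
  using measurable_coordinate_combination[of B "\<lambda>b. b" B "\<lambda>b. b"] by simp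

lemma orthonormal_basis_of_exists:
  assumes "subspace X"
  shows "\<exists>B. orthonormal_basis_of X B"
  using orthonormal_basis_subspace[OF assms] unfolding orthonormal_basis_of_def by metis

lemma
  assumes "orthonormal_basis_of X B"
  shows orthonormal_basis_finite: "finite B"
    and orthonormal_basis_card: "card B = dim X"
    and orthonormal_basis_subspace: "subspace X"
    and orthonormal_basis_inner: "b \<in> B \<Longrightarrow> c \<in> B \<Longrightarrow> b \<bullet> c = (if b = c then 1 else 0)"
proof -
  have "0 \<notin> B"
    using assms by (auto simp: orthonormal_basis_of_def)
  then have ind: "independent B"
    using assms by (intro pairwise_orthogonal_independent) (auto simp: orthonormal_basis_of_def)
  then show "finite B" by (rule independent_imp_finite)
  show "card B = dim X" "subspace X"
    using ind assms by (auto simp: orthonormal_basis_of_def dim_span dim_eq_card_independent[symmetric])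
  show "b \<in> B \<Longrightarrow> c \<in> B \<Longrightarrow> b \<bullet> c = (if b = c then 1 else 0)"
    using assms by (auto simp: orthonormal_basis_of_def pairwise_def orthogonal_def norm_eq_1)
qed

lemma orthonormal_basis_of_Un:
  assumes "orthonormal_basis_of X B" "orthonormal_basis_of Y C"
    and "Y \<subseteq> X\<^sup>\<bottom>"
  shows "orthonormal_basis_of (X + Y) (B \<union> C)" "B \<inter> C = {}"
proof -
  have sub: "B \<subseteq> X" "C \<subseteq> Y" "span B = X" "span C = Y"
    using assms(1,2) span_superset by (auto simp: orthonormal_basis_of_def)
  have orth: "b \<bullet> c = 0" if "b \<in> B" "c \<in> C" for b c
    using that sub assms(3) by (fastforce simp: orth_comp_iff inner_commute)
  have orth': "c \<bullet> b = 0" if "b \<in> B" "c \<in> C" for b c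
    using orth[OF that] by (simp add: inner_commute)
  have "span (B \<union> C) = X + Y"
    using sub by (auto simp: span_Un set_plus_def)
  then show "orthonormal_basis_of (X + Y) (B \<union> C)"
    using assms(1,2) orth orth' unfolding orthonormal_basis_of_def
    by (auto simp: pairwise_def orthogonal_def)
  show "B \<inter> C = {}"
    using orth orthonormal_basis_inner[OF assms(1)] by fastforce
qed

text \<open>
  An isometry carrying the standard basis to B reduces this to the rotation invariance of
  Lebesgue measure.
\<close>

lemma distr_PiM_orthonormal_basis_UNIV:
  fixes B :: "(real ^ 'n) set"
  assumes B: "orthonormal_basis_of UNIV B"
  shows "distr (\<Pi>\<^sub>M b\<in>B. lborel) borel (\<lambda>c. \<Sum>b\<in>B. c b *\<^sub>R b) = lborel"
proof -
  note fin = orthonormal_basis_finite[OF B]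
  have "card B = card (Basis :: (real ^ 'n) set)"
    using orthonormal_basis_card[OF B] by simp
  then obtain h where h: "bij_betw h (Basis :: (real ^ 'n) set) B"
    using fin by (metis finite_Basis finite_same_card_bij)
  define g where "g x = (\<Sum>b\<in>Basis. (x \<bullet> b) *\<^sub>R h b)" for x :: "real ^ 'n"
  have h_inner: "h b \<bullet> h c = (if b = c then 1 else 0)" if "b \<in> Basis" "c \<in> Basis" for b c
    using that h orthonormal_basis_inner[OF B, of "h b" "h c"]
    by (auto simp: bij_betw_def inj_on_def)
  have g: "orthogonal_transformation g"
    unfolding orthogonal_transformation_def
  proof (intro conjI allI)
    show "linear g"
      unfolding g_def by (intro linearI)
        (auto simp: inner_simps algebra_simps sum.distrib scaleR_sum_right)
    fix v w
    have "g v \<bullet> g w = (\<Sum>b\<in>Basis. \<Sum>c\<in>Basis. (v \<bullet> b) * ((w \<bullet> c) * (h b \<bullet> h c)))"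
      by (simp add: g_def inner_sum_left inner_sum_right sum_distrib_left mult.left_commute)
         (rule sum.swap)
    also have "\<dots> = (\<Sum>b\<in>Basis. \<Sum>c\<in>Basis. if b = c then (v \<bullet> b) * (w \<bullet> b) else 0)"
      by (intro sum.cong refl) (auto simp: h_inner)
    also have "\<dots> = v \<bullet> w"
      by (subst euclidean_inner) simp
    finally show "g v \<bullet> g w = v \<bullet> w" .
  qed
  note [measurable] = measurable_orthogonal_transformation[OF g]
  define k where "k = inv_into Basis h"
  have hk: "h (k b) = b" "k b \<in> Basis" if "b \<in> B" for b
    using that h by (auto simp: k_def bij_betw_def f_inv_into_f inv_into_into)
  have kh: "k (h b) = b" "h b \<in> B" if "b \<in> Basis" for b
    using that h by (auto simp: k_def bij_betw_def)
  let ?S = "\<lambda>c. \<Sum>b\<in>Basis. c (h b) *\<^sub>R b"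
  have "lborel = distr (\<Pi>\<^sub>M b\<in>B. lborel) borel ?S"
  proof (rule lborel_eqI)
    have [measurable]: "?S \<in> borel_measurable (\<Pi>\<^sub>M b\<in>B. lborel)"
      using kh by (intro measurable_coordinate_combination) auto
    fix l u :: "real ^ 'n" assume le: "\<And>b. b \<in> Basis \<Longrightarrow> l \<bullet> b \<le> u \<bullet> b"
    have "?S -` box l u \<inter> space (\<Pi>\<^sub>M b\<in>B. lborel) = (\<Pi>\<^sub>E b\<in>B. {l \<bullet> k b <..< u \<bullet> k b})"
    proof (intro set_eqI)
      fix c :: "(real ^ 'n) \<Rightarrow> real"
      have "c \<in> ?S -` box l u \<longleftrightarrow> (\<forall>b\<in>Basis. l \<bullet> b < c (h b) \<and> c (h b) < u \<bullet> b)"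
        by (simp add: mem_box inner_sum_left inner_Basis if_distrib[of "\<lambda>x. _ * x"] cong: if_cong)
      also have "\<dots> \<longleftrightarrow> (\<forall>b\<in>B. l \<bullet> k b < c b \<and> c b < u \<bullet> k b)"
        using hk kh by (metis (no_types, lifting))
      finally show "c \<in> ?S -` box l u \<inter> space (\<Pi>\<^sub>M b\<in>B. lborel)
          \<longleftrightarrow> c \<in> (\<Pi>\<^sub>E b\<in>B. {l \<bullet> k b <..< u \<bullet> k b})"
        by (auto simp: space_PiM PiE_iff)
    qed
    then have "emeasure (distr (\<Pi>\<^sub>M b\<in>B. lborel) borel ?S) (box l u)
        = emeasure (\<Pi>\<^sub>M b\<in>B. lborel) (\<Pi>\<^sub>E b\<in>B. {l \<bullet> k b <..< u \<bullet> k b})"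
      by (simp add: emeasure_distr)
    also have "\<dots> = (\<Prod>b\<in>B. ennreal (u \<bullet> k b - l \<bullet> k b))"
      using fin hk le by (subst lborel_family.emeasure_PiM) (auto intro!: prod.cong)
    also have "\<dots> = (\<Prod>b\<in>Basis. ennreal ((u - l) \<bullet> b))"
      by (rule prod.reindex_bij_betw[OF h, symmetric, THEN trans])
         (auto simp: kh inner_diff_left intro!: prod.cong)
    also have "\<dots> = ennreal (\<Prod>b\<in>Basis. (u - l) \<bullet> b)"
      using le by (subst prod_ennreal) (auto simp: inner_diff_left)
    finally show "emeasure (distr (\<Pi>\<^sub>M b\<in>B. lborel) borel ?S) (box l u)
        = (\<Prod>b\<in>Basis. (u - l) \<bullet> b)" .
  qed simp
  then have "lborel = distr (distr (\<Pi>\<^sub>M b\<in>B. lborel) borel ?S) borel g"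
    using distr_lborel_orthogonal_transformation[OF g] by simp
  also have "\<dots> = distr (\<Pi>\<^sub>M b\<in>B. lborel) borel (g \<circ> ?S)"
    using kh by (intro distr_distr measurable_coordinate_combination) auto
  also have "g \<circ> ?S = (\<lambda>c. \<Sum>b\<in>B. c b *\<^sub>R b)"
  proof
    fix c
    have "(g \<circ> ?S) c = (\<Sum>b\<in>Basis. c (h b) *\<^sub>R h b)"
      by (auto simp: g_def inner_sum_left inner_Basis if_distrib[of "\<lambda>x. _ * x"] cong: if_cong intro!: sum.cong)
    also have "\<dots> = (\<Sum>b\<in>B. c b *\<^sub>R b)"
      by (rule sum.reindex_bij_betw[OF h])
    finally show "(g \<circ> ?S) c = (\<Sum>b\<in>B. c b *\<^sub>R b)" .
  qed
  finally show ?thesis ..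
qed

lemma nn_integral_gaussian_real:
  assumes "t > 0"
  shows "(\<integral>\<^sup>+c. ennreal (exp (- t * c\<^sup>2)) \<partial>lborel) = ennreal (sqrt (pi / t))"
proof -
  define \<sigma> where "\<sigma> = sqrt (1 / (2 * t))"
  have \<sigma>: "\<sigma> > 0" "\<sigma>\<^sup>2 = 1 / (2 * t)"
    using assms by (auto simp: \<sigma>_def)
  have "(\<integral>\<^sup>+c. ennreal (normal_density 0 \<sigma> c) \<partial>lborel) = 1"
    using prob_space.emeasure_space_1[OF prob_space_normal_density[OF \<sigma>(1), of 0]]
    by (simp add: emeasure_density)
  moreover have "ennreal (exp (- t * c\<^sup>2)) = ennreal (sqrt (pi / t)) * ennreal (normal_density 0 \<sigma> c)" for c
    using assms \<sigma> by (simp add: normal_density_def ennreal_mult[symmetric] real_sqrt_divide)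
  ultimately show ?thesis
    by (simp add: nn_integral_cmult)
qed

lemma nn_integral_gaussian_PiM:
  assumes B: "orthonormal_basis_of X B" and "t > 0"
  shows "(\<integral>\<^sup>+c. ennreal (exp (- t * (norm (\<Sum>b\<in>B. c b *\<^sub>R b))\<^sup>2)) \<partial>(\<Pi>\<^sub>M b\<in>B. lborel))
       = ennreal (sqrt (pi / t) ^ dim X)"
proof -
  note fin = orthonormal_basis_finite[OF B]
  have norm: "(norm (\<Sum>b\<in>B. c b *\<^sub>R b))\<^sup>2 = (\<Sum>b\<in>B. (c b)\<^sup>2)" for c
    using B fin by (subst norm_sum_Pythagorean)
      (auto simp: orthonormal_basis_of_def pairwise_def orthogonal_clauses)
  have "(\<integral>\<^sup>+c. ennreal (exp (- t * (norm (\<Sum>b\<in>B. c b *\<^sub>R b))\<^sup>2)) \<partial>(\<Pi>\<^sub>M b\<in>B. lborel))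
      = (\<integral>\<^sup>+c. (\<Prod>b\<in>B. ennreal (exp (- t * (c b)\<^sup>2))) \<partial>(\<Pi>\<^sub>M b\<in>B. lborel))"
    unfolding norm using fin by (simp add: prod_ennreal exp_sum sum_distrib_left sum_negf[symmetric])
  also have "\<dots> = (\<Prod>b\<in>B. \<integral>\<^sup>+c. ennreal (exp (- t * c\<^sup>2)) \<partial>lborel)"
    using fin by (intro lborel_family.product_nn_integral_prod) auto
  also have "\<dots> = ennreal (sqrt (pi / t) ^ dim X)"
    using assms orthonormal_basis_card[OF B]
    by (subst nn_integral_gaussian_real) (simp_all add: ennreal_power)
  finally show ?thesis .
qed

text \<open>
  Fubini for coordinates with respect to the union of two orthonormal bases, transported to the vectors
that they describe.
\<close>

lemma nn_integral_PiM_orthogonal_sum: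
  fixes h :: "real ^ 'n \<Rightarrow> ennreal"
  assumes B: "orthonormal_basis_of X B" and C: "orthonormal_basis_of Y C"
    and orth: "Y \<subseteq> X\<^sup>\<bottom>"
    and [measurable]: "h \<in> borel_measurable borel"
  shows "(\<integral>\<^sup>+c. h (\<Sum>b\<in>B \<union> C. c b *\<^sub>R b) \<partial>(\<Pi>\<^sub>M b\<in>B \<union> C. lborel))
       = (\<integral>\<^sup>+c. (\<integral>\<^sup>+d. h ((\<Sum>b\<in>B. c b *\<^sub>R b) + (\<Sum>b\<in>C. d b *\<^sub>R b)) \<partial>(\<Pi>\<^sub>M b\<in>C. lborel))
            \<partial>(\<Pi>\<^sub>M b\<in>B. lborel))"
proof -
  note fin = orthonormal_basis_finite[OF B] orthonormal_basis_finite[OF C]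
  note disj = orthonormal_basis_of_Un(2)[OF B C orth]
  have merge: "(\<Sum>b\<in>B \<union> C. merge B C (c, d) b *\<^sub>R b) = (\<Sum>b\<in>B. c b *\<^sub>R b) + (\<Sum>b\<in>C. d b *\<^sub>R b)"
    for c d :: "real ^ 'n \<Rightarrow> real"
  proof -
    have "(\<Sum>b\<in>B. merge B C (c, d) b *\<^sub>R b) = (\<Sum>b\<in>B. c b *\<^sub>R b)"
      by (intro sum.cong) (auto simp: merge_def)
    moreover have "(\<Sum>b\<in>C. merge B C (c, d) b *\<^sub>R b) = (\<Sum>b\<in>C. d b *\<^sub>R b)"
      using disj by (intro sum.cong) (auto simp: merge_def)
    ultimately show ?thesis
      using disj by (simp add: sum.union_disjoint[OF fin])
  qed
  have "(\<lambda>c. h (\<Sum>b\<in>B \<union> C. c b *\<^sub>R b)) \<in> borel_measurable (\<Pi>\<^sub>M b\<in>B \<union> C. lborel)"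
    by (rule measurable_compose[OF measurable_basis_combination assms(4)])
  then have "(\<integral>\<^sup>+c. h (\<Sum>b\<in>B \<union> C. c b *\<^sub>R b) \<partial>(\<Pi>\<^sub>M b\<in>B \<union> C. lborel))
      = (\<integral>\<^sup>+c. (\<integral>\<^sup>+d. h (\<Sum>b\<in>B \<union> C. merge B C (c, d) b *\<^sub>R b) \<partial>(\<Pi>\<^sub>M b\<in>C. lborel))
           \<partial>(\<Pi>\<^sub>M b\<in>B. lborel))"
    by (rule lborel_family.product_nn_integral_fold[OF disj fin])
  then show ?thesis
    unfolding merge .
qed

text \<open>
  The weight has integral 1 over the orthogonal complement of X, whatever its dimension; hence the
factor pi in the exponent.
\<close>

definition transverse_gaussian :: "(real ^ 'n) set \<Rightarrow> real ^ 'n \<Rightarrow> real" where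
  "transverse_gaussian X x = exp (- pi * (norm (x - proj X x))\<^sup>2)"

lemma transverse_gaussian_pos: "transverse_gaussian X x > 0"
  by (simp add: transverse_gaussian_def)

lemma measurable_transverse_gaussian:
  "subspace X \<Longrightarrow> transverse_gaussian X \<in> borel_measurable borel"
  unfolding transverse_gaussian_def[abs_def] using measurable_proj[of X] by measurable

text \<open>
  Complete B to an orthonormal basis of the whole space.  Lebesgue measure factors along the two halves of
the basis, and the Gaussian integrates to 1 over the coordinates transverse to X.  The right-hand side
does not mention B, hence neither basis nor choice matters.
\<close>

lemma distr_PiM_orthonormal_basis:
  fixes X :: "(real ^ 'n) set"
  assumes B: "orthonormal_basis_of X B"
  shows "distr (\<Pi>\<^sub>M b\<in>B. lborel) borel (\<lambda>c. \<Sum>b\<in>B. c b *\<^sub>R b)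
       = distr (density lborel (\<lambda>x. ennreal (transverse_gaussian X x))) borel (proj X)"
    (is "?L = ?R")
proof (rule measure_eqI)
  note X = orthonormal_basis_subspace[OF B]
  note [measurable] = measurable_proj[OF X] measurable_transverse_gaussian[OF X]
  obtain C where C: "orthonormal_basis_of (X\<^sup>\<bottom>) C"
    using orthonormal_basis_of_exists subspace_orthogonal_comp by blast
  have BC: "orthonormal_basis_of UNIV (B \<union> C)"
    using orthonormal_basis_of_Un(1)[OF B C] subspace_sum_orthogonal_comp[OF X] by simp
  fix A assume "A \<in> sets ?L"
  then have [measurable]: "A \<in> sets borel" by simp
  let ?h = "\<lambda>x. indicator A (proj X x) * ennreal (transverse_gaussian X x)"
  have split: "?h (x + y) = indicator A x * ennreal (exp (- pi * (norm y)\<^sup>2))"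
    if "x \<in> X" "y \<in> X\<^sup>\<bottom>" for x y
  proof -
    have "proj X (x + y) = x"
      using that by (intro proj_eqI X) (auto simp: orth_comp_iff)
    then show ?thesis by (simp add: transverse_gaussian_def)
  qed
  have "B \<subseteq> X" "C \<subseteq> X\<^sup>\<bottom>"
    using B C span_superset unfolding orthonormal_basis_of_def by metis+
  then have in_span: "(\<Sum>b\<in>B. c b *\<^sub>R b) \<in> X" "(\<Sum>b\<in>C. c b *\<^sub>R b) \<in> X\<^sup>\<bottom>" for c :: "real ^ 'n \<Rightarrow> real"
    by (auto intro!: subspace_sum subspace_scale X subspace_orthogonal_comp)
  have "emeasure ?R A = (\<integral>\<^sup>+x. indicator A x \<partial>?R)"
    by simp
  also have "\<dots> = (\<integral>\<^sup>+x. ?h x \<partial>lborel)"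
    by (subst nn_integral_distr, measurable) (simp add: nn_integral_density mult.commute)
  also have "\<dots> = (\<integral>\<^sup>+c. ?h (\<Sum>b\<in>B \<union> C. c b *\<^sub>R b) \<partial>(\<Pi>\<^sub>M b\<in>B \<union> C. lborel))"
    by (subst distr_PiM_orthonormal_basis_UNIV[OF BC, symmetric], subst nn_integral_distr) auto
  also have "\<dots> = (\<integral>\<^sup>+c. (\<integral>\<^sup>+d. ?h ((\<Sum>b\<in>B. c b *\<^sub>R b) + (\<Sum>b\<in>C. d b *\<^sub>R b)) \<partial>(\<Pi>\<^sub>M b\<in>C. lborel))
            \<partial>(\<Pi>\<^sub>M b\<in>B. lborel))"
    by (rule nn_integral_PiM_orthogonal_sum[OF B C]) auto
  also have "\<dots> = (\<integral>\<^sup>+c. indicator A (\<Sum>b\<in>B. c b *\<^sub>R b) *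
      (\<integral>\<^sup>+d. ennreal (exp (- pi * (norm (\<Sum>b\<in>C. d b *\<^sub>R b))\<^sup>2)) \<partial>(\<Pi>\<^sub>M b\<in>C. lborel))
            \<partial>(\<Pi>\<^sub>M b\<in>B. lborel))"
    by (subst split[OF in_span]) (simp add: nn_integral_cmult)
  also have "\<dots> = (\<integral>\<^sup>+c. indicator A (\<Sum>b\<in>B. c b *\<^sub>R b) \<partial>(\<Pi>\<^sub>M b\<in>B. lborel))"
    by (subst nn_integral_gaussian_PiM[OF C]) simp_all
  also have "\<dots> = (\<integral>\<^sup>+x. indicator A x \<partial>?L)"
    by (subst nn_integral_distr) auto
  finally show "emeasure ?L A = emeasure ?R A" by simp
qed simp

lemma subspace_lborel_eq_basis:
  assumes "orthonormal_basis_of X B"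
  shows "subspace_lborel X = distr (\<Pi>\<^sub>M b\<in>B. lborel) borel (\<lambda>c. \<Sum>b\<in>B. c b *\<^sub>R b)"
proof -
  have "orthonormal_basis_of X (SOME B. orthonormal_basis_of X B)"
    using assms by (rule someI)
  then show ?thesis
    unfolding subspace_lborel_def Let_def
    by (simp only: distr_PiM_orthonormal_basis distr_PiM_orthonormal_basis[OF assms])
qed

lemma subspace_lborel_eq:
  assumes "subspace X"
  shows "subspace_lborel X
       = distr (density lborel (\<lambda>x. ennreal (transverse_gaussian X x))) borel (proj X)"
proof -
  obtain B where "orthonormal_basis_of X B"
    using orthonormal_basis_of_exists[OF assms] ..
  then show ?thesis
    by (simp only: subspace_lborel_eq_basis distr_PiM_orthonormal_basis)
qed

lemma sets_subspace_lborel[simp, measurable_cong]: "sets (subspace_lborel X) = sets borel"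
  and space_subspace_lborel[simp]: "space (subspace_lborel X) = UNIV"
  by (simp_all add: subspace_lborel_def Let_def)

lemma nn_integral_subspace_lborel:
  fixes h :: "real ^ 'n \<Rightarrow> ennreal"
  assumes X: "subspace X" and [measurable]: "h \<in> borel_measurable borel"
  shows "(\<integral>\<^sup>+x. h x \<partial>subspace_lborel X)
       = (\<integral>\<^sup>+x. ennreal (transverse_gaussian X x) * h (proj X x) \<partial>lborel)"
proof -
  note [measurable] = measurable_proj[OF X] measurable_transverse_gaussian[OF X]
  show ?thesis
    unfolding subspace_lborel_eq[OF X]
    by (subst nn_integral_distr, measurable) (simp add: nn_integral_density)
qed

lemma integral_subspace_lborel:
  fixes h :: "real ^ 'n \<Rightarrow> 'b::{banach, second_countable_topology}"
  assumes X: "subspace X" and [measurable]: "h \<in> borel_measurable borel"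
  shows "(LINT x|subspace_lborel X. h x)
       = (LINT x|lborel. transverse_gaussian X x *\<^sub>R h (proj X x))"
proof -
  note [measurable] = measurable_proj[OF X] measurable_transverse_gaussian[OF X]
  show ?thesis
    unfolding subspace_lborel_eq[OF X]
    by (subst integral_distr, measurable)
       (simp add: integral_density transverse_gaussian_pos less_imp_le)
qed

lemma AE_subspace_lborel_in:
  assumes X: "subspace X"
  shows "AE x in subspace_lborel X. x \<in> X"
proof -
  note [measurable] = measurable_proj[OF X] measurable_transverse_gaussian[OF X]
  have "{x \<in> space borel. x \<in> X} \<in> sets borel"
    using X by (simp add: closed_subspace borel_closed)
  then show ?thesis
    unfolding subspace_lborel_eq[OF X] using proj_in[OF X] by (subst AE_distr_iff) auto
qed

lemma nn_integral_subspace_lborel_plus: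
  fixes h :: "real ^ 'n \<Rightarrow> ennreal"
  assumes X: "subspace X" and Y: "subspace Y"
    and orth: "Y \<subseteq> X\<^sup>\<bottom>"
    and [measurable]: "h \<in> borel_measurable borel"
  shows "(\<integral>\<^sup>+z. h z \<partial>subspace_lborel (X + Y))
       = (\<integral>\<^sup>+x. (\<integral>\<^sup>+y. h (x + y) \<partial>subspace_lborel Y) \<partial>subspace_lborel X)"
proof -
  obtain B C where B: "orthonormal_basis_of X B" and C: "orthonormal_basis_of Y C"
    using orthonormal_basis_of_exists X Y by metis
  note [measurable] = measurable_proj[OF Y] measurable_transverse_gaussian[OF Y]
  have "(\<integral>\<^sup>+z. h z \<partial>subspace_lborel (X + Y))
      = (\<integral>\<^sup>+c. h (\<Sum>b\<in>B \<union> C. c b *\<^sub>R b) \<partial>(\<Pi>\<^sub>M b\<in>B \<union> C. lborel))"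
    using subspace_lborel_eq_basis[OF orthonormal_basis_of_Un(1)[OF B C orth]]
    by (simp add: nn_integral_distr)
  also have "\<dots> = (\<integral>\<^sup>+c. (\<integral>\<^sup>+d. h ((\<Sum>b\<in>B. c b *\<^sub>R b) + (\<Sum>b\<in>C. d b *\<^sub>R b)) \<partial>(\<Pi>\<^sub>M b\<in>C. lborel))
            \<partial>(\<Pi>\<^sub>M b\<in>B. lborel))"
    by (rule nn_integral_PiM_orthogonal_sum[OF B C orth]) auto
  also have "\<dots> = (\<integral>\<^sup>+c. (\<integral>\<^sup>+y. h ((\<Sum>b\<in>B. c b *\<^sub>R b) + y) \<partial>subspace_lborel Y) \<partial>(\<Pi>\<^sub>M b\<in>B. lborel))"
    unfolding subspace_lborel_eq_basis[OF C]
    by (subst nn_integral_distr) auto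
  also have "\<dots> = (\<integral>\<^sup>+x. (\<integral>\<^sup>+y. h (x + y) \<partial>subspace_lborel Y) \<partial>subspace_lborel X)"
    unfolding subspace_lborel_eq_basis[OF B]
    by (subst nn_integral_distr) (auto simp: nn_integral_subspace_lborel[OF Y])
  finally show ?thesis .
qed

lemma nn_integral_subspace_lborel_translation:
  fixes h :: "real ^ 'n \<Rightarrow> ennreal"
  assumes X: "subspace X" and "a \<in> X" and [measurable]: "h \<in> borel_measurable borel"
  shows "(\<integral>\<^sup>+x. h (a + x) \<partial>subspace_lborel X) = (\<integral>\<^sup>+x. h x \<partial>subspace_lborel X)"
proof -
  note [measurable] = measurable_proj[OF X] measurable_transverse_gaussian[OF X]
  have *: "proj X (a + x) = a + proj X x" for x
    by (simp add: linear_add[OF linear_proj[OF X]] proj_self X \<open>a \<in> X\<close>)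
  have "(\<integral>\<^sup>+x. h (a + x) \<partial>subspace_lborel X)
      = (\<integral>\<^sup>+x. ennreal (transverse_gaussian X (a + x)) * h (proj X (a + x)) \<partial>lborel)"
    by (simp add: nn_integral_subspace_lborel[OF X] * transverse_gaussian_def)
  also have "\<dots> = (\<integral>\<^sup>+x. h x \<partial>subspace_lborel X)"
    by (subst nn_integral_lborel_translation) (simp_all add: nn_integral_subspace_lborel[OF X])
  finally show ?thesis .
qed

lemma nn_integral_gaussian_subspace:
  assumes X: "subspace X" and "t > 0"
  shows "(\<integral>\<^sup>+x. ennreal (exp (- t * (norm x)\<^sup>2)) \<partial>subspace_lborel X)
       = ennreal ((pi / t) powr (real (dim X) / 2))"
proof -
  obtain B where B: "orthonormal_basis_of X B"
    using orthonormal_basis_of_exists X by metis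
  have "sqrt (pi / t) ^ dim X = (pi / t) powr (real (dim X) / 2)"
    using assms by (simp add: powr_half_sqrt[symmetric] powr_powr flip: powr_realpow)
  then show ?thesis
    unfolding subspace_lborel_eq_basis[OF B]
    by (subst nn_integral_distr) (auto simp: nn_integral_gaussian_PiM[OF B \<open>t > 0\<close>, simplified])
qed

text \<open>
  On a ball of radius n the constant 1 is at most exp(n^2) times a Gaussian, which has finite integral.
\<close>

lemma sigma_finite_subspace_lborel:
  assumes X: "subspace X"
  shows "sigma_finite_measure (subspace_lborel X)"
proof
  have fin: "emeasure (subspace_lborel X) (cball 0 (real n)) \<noteq> \<infinity>" for n
  proof -
    have "emeasure (subspace_lborel X) (cball 0 (real n))
        = (\<integral>\<^sup>+x. indicator (cball 0 (real n)) x \<partial>subspace_lborel X)"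
      by simp
    also have "\<dots> \<le> (\<integral>\<^sup>+x. ennreal (exp ((real n)\<^sup>2)) * ennreal (exp (- 1 * (norm x)\<^sup>2)) \<partial>subspace_lborel X)"
      by (intro nn_integral_mono)
         (auto simp: indicator_def ennreal_mult[symmetric] exp_add[symmetric] power_mono ennreal_1[symmetric] simp del: ennreal_1 intro!: ennreal_leI)
    also have "\<dots> = ennreal (exp ((real n)\<^sup>2)) * ennreal ((pi / 1) powr (real (dim X) / 2))"
      by (subst nn_integral_cmult, simp, subst nn_integral_gaussian_subspace[OF X]) auto
    also have "\<dots> < \<infinity>"
      by (simp add: ennreal_mult_less_top)
    finally show ?thesis by simp
  qed
  have "(\<Union>n. cball 0 (real n)) = (UNIV :: (real ^ 'n) set)"
    using real_arch_simple by auto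
  then show "\<exists>A. countable A \<and> A \<subseteq> sets (subspace_lborel X) \<and> \<Union> A = space (subspace_lborel X)
      \<and> (\<forall>a\<in>A. emeasure (subspace_lborel X) a \<noteq> \<infinity>)"
    using fin by (intro exI[of _ "range (\<lambda>n. cball 0 (real n))"]) auto
qed

text \<open>
  Riesz kernels take the value 0 at the origin, where they are really infinite; in positive dimension
this point is negligible.
\<close>

lemma AE_subspace_lborel_neq:
  assumes X: "subspace X" and "dim X > 0"
  shows "AE x in subspace_lborel X. x \<noteq> a"
proof -
  obtain B where B: "orthonormal_basis_of X B"
    using orthonormal_basis_of_exists X by metis
  note fin = orthonormal_basis_finite[OF B]
  obtain b where b: "b \<in> B"
    using orthonormal_basis_card[OF B] \<open>dim X > 0\<close> by (metis card.empty ex_in_conv less_irrefl)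
  have "AE c in (\<Pi>\<^sub>M b\<in>B. lborel :: real measure). c b \<noteq> a \<bullet> b"
  proof (rule AE_I)
    let ?N = "\<Pi>\<^sub>E i\<in>B. if i = b then {a \<bullet> b} else (UNIV :: real set)"
    show "{c \<in> space (\<Pi>\<^sub>M b\<in>B. lborel). \<not> c b \<noteq> a \<bullet> b} \<subseteq> ?N"
      by (auto simp: space_PiM PiE_iff extensional_def)
    show "?N \<in> sets (\<Pi>\<^sub>M b\<in>B. lborel)"
      using fin by (intro sets_PiM_I_finite) auto
    show "emeasure (\<Pi>\<^sub>M b\<in>B. lborel) ?N = 0"
      using fin b by (subst lborel_family.emeasure_PiM) (auto intro!: prod_zero bexI[of _ b])
  qed
  moreover have "(\<Sum>i\<in>B. c i *\<^sub>R i) \<bullet> b = c b" for c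
    using b fin orthonormal_basis_inner[OF B]
    by (simp add: inner_sum_left if_distrib[of "\<lambda>x. _ * x"] cong: if_cong)
  ultimately have "AE c in (\<Pi>\<^sub>M b\<in>B. lborel :: real measure). (\<Sum>i\<in>B. c i *\<^sub>R i) \<noteq> a"
    by (auto elim!: eventually_mono)
  then show ?thesis
    unfolding subspace_lborel_eq_basis[OF B] by (subst AE_distr_iff) auto
qed

section \<open>Riesz kernels\<close>

text \<open>
  The Gamma integral after rescaling.  It writes a negative power of r as a mixture of exponentials, which
turns the powers of the norm in Riesz kernels into mixtures of Gaussians.
\<close>

lemma nn_integral_powr_exp:
  fixes r s :: real
  assumes "r > 0" "s > 0"
  shows "(\<integral>\<^sup>+t. ennreal (indicator {0<..} t * t powr (s - 1) * exp (- (t * r))) \<partial>lborel)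
       = ennreal (Gamma s / r powr s)"
proof -
  let ?f = "\<lambda>t. ennreal (indicator {0..} t * t powr (s - 1) / exp t)"
  have "ennreal (Gamma s) = ennreal r * (\<integral>\<^sup>+t. ?f (0 + r * t) \<partial>lborel)"
    using assms unfolding Gamma_conv_nn_integral_real[OF \<open>s > 0\<close>]
    by (subst nn_integral_real_affine[of ?f r 0]) simp_all
  also have "\<dots> = ennreal r * (\<integral>\<^sup>+t. ennreal (r powr (s - 1)) *
      ennreal (indicator {0<..} t * t powr (s - 1) * exp (- (t * r))) \<partial>lborel)"
    using assms
    by (intro arg_cong[where f = "\<lambda>x. ennreal r * x"] nn_integral_cong)
       (auto simp: ennreal_mult[symmetric] indicator_def powr_mult exp_minus field_simps
         zero_le_mult_iff)
  also have "\<dots> = ennreal (r powr s) *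
      (\<integral>\<^sup>+t. ennreal (indicator {0<..} t * t powr (s - 1) * exp (- (t * r))) \<partial>lborel)"
  proof -
    have "r * r powr (s - 1) = r powr s"
      using assms by (simp add: powr_mult_base)
    then show ?thesis
      using assms
      by (subst nn_integral_cmult, simp) (simp add: mult.assoc[symmetric] ennreal_mult''[symmetric])
  qed
  finally have "ennreal (1 / r powr s) * ennreal (Gamma s) = ennreal (1 / r powr s) * (ennreal (r powr s) *
      (\<integral>\<^sup>+t. ennreal (indicator {0<..} t * t powr (s - 1) * exp (- (t * r))) \<partial>lborel))"
    by simp
  then show ?thesis
    using assms by (simp add: mult.assoc[symmetric] ennreal_mult[symmetric])
qed

text \<open>
  For x in C, the number |x + z|^2 is |x|^2 + |z|^2.  Writing its power as a mixture of exponentials,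
the Gaussian in x integrates to (pi/t) powr (dim C / 2), and what is left is a Gamma integral with the
exponent lowered by dim C / 2.  Convergence at infinity is the condition on s.
\<close>

lemma nn_integral_inverse_power_subspace:
  fixes C :: "(real ^ 'n) set" and z :: "real ^ 'n" and s :: real
  assumes C: "subspace C" and z: "z \<in> C\<^sup>\<bottom>" "z \<noteq> 0" and s: "s > dim C / 2"
  shows "(\<integral>\<^sup>+x. ennreal (1 / norm (x + z) powr (2 * s)) \<partial>subspace_lborel C)
       = ennreal (pi powr (dim C / 2) * Gamma (s - dim C / 2) / Gamma s / norm z powr (2 * s - dim C))"
proof -
  interpret C: sigma_finite_measure "subspace_lborel C"
    by (rule sigma_finite_subspace_lborel[OF C])
  interpret pair_sigma_finite "subspace_lborel C" "lborel :: real measure" ..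
  have "s > 0" using s by (simp add: le_less_trans[OF _ s])
  then have \<Gamma>: "Gamma s > 0" by simp
  let ?g = "\<lambda>t r. ennreal (indicator {0<..} t * t powr (s - 1) * exp (- (t * r)))"
  have "ennreal (1 / norm (x + z) powr (2 * s))
      = (\<integral>\<^sup>+t. ennreal (1 / Gamma s) * ?g t ((norm x)\<^sup>2 + (norm z)\<^sup>2) \<partial>lborel)"
    if "x \<in> C" for x
  proof -
    have "orthogonal x z"
      using z that by (auto simp: orthogonal_def orth_comp_iff inner_commute)
    then have n: "(norm (x + z))\<^sup>2 = (norm x)\<^sup>2 + (norm z)\<^sup>2"
      by (rule norm_add_Pythagorean)
    have pos: "(norm x)\<^sup>2 + (norm z)\<^sup>2 > 0"
      using z by (simp add: add_nonneg_pos)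
    then have "norm (x + z) > 0"
      using n by (metis norm_eq_zero zero_less_norm_iff zero_power2 less_irrefl)
    then have "norm (x + z) powr (2 * s) = ((norm x)\<^sup>2 + (norm z)\<^sup>2) powr s"
      unfolding n[symmetric] by (simp add: powr_powr flip: powr_numeral)
    moreover have "(\<integral>\<^sup>+t. ennreal (1 / Gamma s) * ?g t ((norm x)\<^sup>2 + (norm z)\<^sup>2) \<partial>lborel)
        = ennreal (1 / Gamma s) * ennreal (Gamma s / ((norm x)\<^sup>2 + (norm z)\<^sup>2) powr s)"
      by (subst nn_integral_cmult, simp) (simp only: nn_integral_powr_exp[OF pos \<open>s > 0\<close>])
    moreover have "\<dots> = ennreal (1 / Gamma s * (Gamma s / ((norm x)\<^sup>2 + (norm z)\<^sup>2) powr s))"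
      using \<Gamma> by (intro ennreal_mult[symmetric]) auto
    ultimately show ?thesis
      using \<Gamma> by simp
  qed
  then have "(\<integral>\<^sup>+x. ennreal (1 / norm (x + z) powr (2 * s)) \<partial>subspace_lborel C)
      = (\<integral>\<^sup>+x. (\<integral>\<^sup>+t. ennreal (1 / Gamma s) * ?g t ((norm x)\<^sup>2 + (norm z)\<^sup>2) \<partial>lborel) \<partial>subspace_lborel C)"
    using AE_subspace_lborel_in[OF C] by (intro nn_integral_cong_AE) (auto elim!: eventually_mono)
  also have "\<dots> = (\<integral>\<^sup>+t. (\<integral>\<^sup>+x. ennreal (1 / Gamma s) * ?g t ((norm x)\<^sup>2 + (norm z)\<^sup>2) \<partial>subspace_lborel C) \<partial>lborel)"
    by (intro Fubini'[symmetric]) measurable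
  also have "\<dots> = (\<integral>\<^sup>+t. ennreal (pi powr (dim C / 2) / Gamma s) *
      ennreal (indicator {0<..} t * t powr (s - dim C / 2 - 1) * exp (- (t * (norm z)\<^sup>2))) \<partial>lborel)"
  proof (rule nn_integral_cong)
    fix t :: real
    show "(\<integral>\<^sup>+x. ennreal (1 / Gamma s) * ?g t ((norm x)\<^sup>2 + (norm z)\<^sup>2) \<partial>subspace_lborel C)
        = ennreal (pi powr (dim C / 2) / Gamma s) *
      ennreal (indicator {0<..} t * t powr (s - dim C / 2 - 1) * exp (- (t * (norm z)\<^sup>2)))"
    proof (cases "t > 0")
      case True
      have "(\<integral>\<^sup>+x. ennreal (1 / Gamma s) * ?g t ((norm x)\<^sup>2 + (norm z)\<^sup>2) \<partial>subspace_lborel C)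
          = (\<integral>\<^sup>+x. ennreal (1 / Gamma s * t powr (s - 1) * exp (- (t * (norm z)\<^sup>2))) *
               ennreal (exp (- t * (norm x)\<^sup>2)) \<partial>subspace_lborel C)"
        using True \<open>s > 0\<close> 
        by (intro nn_integral_cong)
           (simp add: ennreal_mult[symmetric] less_imp_le distrib_left exp_add exp_diff exp_minus divide_inverse mult_ac)
      also have "\<dots> = ennreal (1 / Gamma s * t powr (s - 1) * exp (- (t * (norm z)\<^sup>2))) *
           ennreal ((pi / t) powr (dim C / 2))"
        using nn_integral_gaussian_subspace[OF C True] by (subst nn_integral_cmult) auto
      also have "\<dots> = ennreal (pi powr (dim C / 2) / Gamma s) *
          ennreal (indicator {0<..} t * t powr (s - dim C / 2 - 1) * exp (- (t * (norm z)\<^sup>2)))"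
      proof -
        have "t powr (s - 1) * (pi / t) powr (dim C / 2) = pi powr (dim C / 2) * t powr (s - dim C / 2 - 1)"
          using True powr_diff[of t "s - 1" "dim C / 2"]
          by (simp add: powr_divide diff_diff_eq add.commute)
        then show ?thesis
          using True \<open>s > 0\<close>
          by (simp add: ennreal_mult[symmetric] less_imp_le mult_ac)
      qed
      finally show ?thesis .
    qed simp
  qed
  also have "\<dots> = ennreal (pi powr (dim C / 2) / Gamma s) *
      ennreal (Gamma (s - dim C / 2) / ((norm z)\<^sup>2) powr (s - dim C / 2))"
    using z s by (subst nn_integral_cmult, simp, subst nn_integral_powr_exp) auto
  also have "((norm z)\<^sup>2) powr (s - dim C / 2) = norm z powr (2 * s - dim C)"
    using z by (simp add: powr_powr right_diff_distrib flip: powr_numeral)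
  finally show ?thesis
    using s \<open>s > 0\<close> by (simp add: ennreal_mult[symmetric] less_imp_le)
qed

definition riesz_kernel :: "nat \<Rightarrow> real \<Rightarrow> real ^ 'n \<Rightarrow> real" where
  "riesz_kernel d \<alpha> x = 1 / riesz_gamma d \<alpha> * (1 / norm x powr (real d - \<alpha>))"

lemma measurable_riesz_kernel[measurable]: "riesz_kernel d \<alpha> \<in> borel_measurable borel"
  unfolding riesz_kernel_def[abs_def] by measurable

lemma riesz_gamma_pos: "0 < \<alpha> \<Longrightarrow> \<alpha> < real d \<Longrightarrow> riesz_gamma d \<alpha> > 0"
  by (simp add: riesz_gamma_def Gamma_real_pos)

lemma riesz_kernel_nonneg: "0 < \<alpha> \<Longrightarrow> \<alpha> < real d \<Longrightarrow> riesz_kernel d \<alpha> x \<ge> 0"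
  using riesz_gamma_pos[of \<alpha> d] by (simp add: riesz_kernel_def)

lemma riesz_kernel_minus: "riesz_kernel d \<alpha> (- x) = riesz_kernel d \<alpha> x"
  by (simp add: riesz_kernel_def)

text \<open>
  The key property of the constants \<^const>\<open>riesz_gamma\<close>: integrating the kernel of dimension d + m over
a d-dimensional subspace leaves the kernel of dimension m on the orthogonal complement.  The Gamma
factors in numerator and denominator are precisely those produced by the integral.
\<close>

lemma nn_integral_riesz_kernel_subspace:
  fixes C :: "(real ^ 'n) set" and y z :: "real ^ 'n"
  assumes C: "subspace C" and y: "y \<in> C" and z: "z \<in> C\<^sup>\<bottom>" "z \<noteq> 0" and \<alpha>: "0 < \<alpha>" "\<alpha> < real m"
  shows "(\<integral>\<^sup>+x. ennreal (riesz_kernel (dim C + m) \<alpha> (y + x + z)) \<partial>subspace_lborel C)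
       = ennreal (riesz_kernel m \<alpha> z)"
proof -
  define s where "s = (real (dim C + m) - \<alpha>) / 2"
  have s: "s > dim C / 2" "s > 0" and s2: "real (dim C + m) - \<alpha> = 2 * s" "s - dim C / 2 = (real m - \<alpha>) / 2"
      "2 * s - dim C = real m - \<alpha>"
    using \<alpha> by (auto simp: s_def field_simps)
  have pos: "riesz_gamma (dim C + m) \<alpha> > 0"
    using \<alpha> by (intro riesz_gamma_pos) auto
  have "(\<integral>\<^sup>+x. ennreal (riesz_kernel (dim C + m) \<alpha> (y + x + z)) \<partial>subspace_lborel C)
      = (\<integral>\<^sup>+x. ennreal (riesz_kernel (dim C + m) \<alpha> (x + z)) \<partial>subspace_lborel C)"
    by (rule nn_integral_subspace_lborel_translation[OF C y]) measurable
  also have "\<dots> = (\<integral>\<^sup>+x. ennreal (1 / riesz_gamma (dim C + m) \<alpha>) *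
      ennreal (1 / norm (x + z) powr (2 * s)) \<partial>subspace_lborel C)"
    using pos unfolding riesz_kernel_def s2 by (intro nn_integral_cong) (subst ennreal_mult[symmetric], auto)
  also have "\<dots> = ennreal (1 / riesz_gamma (dim C + m) \<alpha>) *
      ennreal (pi powr (dim C / 2) * Gamma (s - dim C / 2) / Gamma s / norm z powr (2 * s - dim C))"
    by (subst nn_integral_cmult) (simp_all add: nn_integral_inverse_power_subspace[OF C z s(1)])
  also have "\<dots> = ennreal (1 / riesz_gamma (dim C + m) \<alpha> *
      (pi powr (dim C / 2) * Gamma (s - dim C / 2) / Gamma s / norm z powr (2 * s - dim C)))"
    using pos s by (subst ennreal_mult[symmetric]) (auto simp: less_imp_le)
  also have "1 / riesz_gamma (dim C + m) \<alpha> *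
      (pi powr (dim C / 2) * Gamma (s - dim C / 2) / Gamma s / norm z powr (2 * s - dim C)) = riesz_kernel m \<alpha> z"
  proof -
    have "Gamma s > 0" "Gamma (\<alpha> / 2) > 0" "Gamma ((real m - \<alpha>) / 2) > 0"
      using s \<alpha> by (auto simp: Gamma_real_pos)
    moreover have "pi powr (real (dim C + m) / 2) = pi powr (dim C / 2) * pi powr (m / 2)"
      by (simp add: powr_add[symmetric] add_divide_distrib)
    moreover have "(real (dim C + m) - \<alpha>) / 2 = s" by (simp add: s_def)
    ultimately show ?thesis
      unfolding riesz_kernel_def riesz_gamma_def s2(2,3) by (simp add: field_simps)
  qed
  finally show ?thesis .
qed

section \<open>The kernel identity for fixed directions\<close>

text \<open>
  Here B + A and B + Q are the fibers over which the two potentials integrate.  Decompose w into its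
components.  On the left the integral over u in A only meets the kernel, on the right the component of
w in Q only meets the kernel; either integration collapses the kernel to the one on B, so that both
sides equal the integral that is called T in the proof.
\<close>

lemma riesz_kernel_identity:
  fixes A B Q :: "(real ^ 'n) set" and v :: "real ^ 'n" and G :: "real ^ 'n \<Rightarrow> ennreal"
  assumes A: "subspace A" and B: "subspace B" and Q: "subspace Q"
    and AB: "A \<subseteq> B\<^sup>\<bottom>" and QB: "Q \<subseteq> B\<^sup>\<bottom>"
    and v: "v \<in> B + Q"
    and \<alpha>: "0 < \<alpha>" "\<alpha> < real (dim B)"
    and [measurable]: "G \<in> borel_measurable borel"
  shows "(\<integral>\<^sup>+u. (\<integral>\<^sup>+w. ennreal (riesz_kernel (dim A + dim B) \<alpha> (u + proj B v - w)) * G w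
            \<partial>subspace_lborel (B + A)) \<partial>subspace_lborel A)
       = (\<integral>\<^sup>+w. ennreal (riesz_kernel (dim Q + dim B) \<alpha> (v - w)) *
            (\<integral>\<^sup>+a. G (a + proj B w) \<partial>subspace_lborel A) \<partial>subspace_lborel (B + Q))"
    (is "?L = ?R")
proof -
  interpret A: sigma_finite_measure "subspace_lborel A" by (rule sigma_finite_subspace_lborel[OF A])
  interpret B: sigma_finite_measure "subspace_lborel B" by (rule sigma_finite_subspace_lborel[OF B])
  interpret Q: sigma_finite_measure "subspace_lborel Q" by (rule sigma_finite_subspace_lborel[OF Q])
  interpret AB: pair_sigma_finite "subspace_lborel A" "subspace_lborel B" ..
  interpret AA: pair_sigma_finite "subspace_lborel A" "subspace_lborel A" ..
  note [measurable] = measurable_proj[OF B]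
  let ?k = "\<lambda>d x. ennreal (riesz_kernel d \<alpha> x)"
  let ?m = "dim B"
  let ?vB = "proj B v"
  have sub_B: "x - ?vB \<in> B" "?vB - x \<in> B" if "x \<in> B" for x
    using that proj_in[OF B] subspace_diff[OF B] by blast+
  have orth: "B \<subseteq> A\<^sup>\<bottom>" "B \<subseteq> Q\<^sup>\<bottom>"
    using AB QB by (fastforce simp: orth_comp_iff inner_commute)+
  have dimB: "dim B > 0"
    using \<alpha> by simp
  have AE_B: "AE b in subspace_lborel B. b \<in> B \<and> b \<noteq> ?vB"
    using AE_subspace_lborel_in[OF B] AE_subspace_lborel_neq[OF B dimB] by eventually_elim simp
  let ?T = "\<integral>\<^sup>+b. ?k ?m (?vB - b) * (\<integral>\<^sup>+a. G (a + b) \<partial>subspace_lborel A) \<partial>subspace_lborel B"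

  have "?L = (\<integral>\<^sup>+u. (\<integral>\<^sup>+b. (\<integral>\<^sup>+a. ?k (dim A + ?m) (u + ?vB - (b + a)) * G (b + a)
       \<partial>subspace_lborel A) \<partial>subspace_lborel B) \<partial>subspace_lborel A)"
    by (intro nn_integral_cong nn_integral_subspace_lborel_plus B A AB) measurable
  also have "\<dots> = (\<integral>\<^sup>+b. (\<integral>\<^sup>+u. (\<integral>\<^sup>+a. ?k (dim A + ?m) (u + ?vB - (b + a)) * G (b + a)
       \<partial>subspace_lborel A) \<partial>subspace_lborel A) \<partial>subspace_lborel B)"
    by (intro AB.Fubini'[symmetric]) measurable
  also have "\<dots> = (\<integral>\<^sup>+b. (\<integral>\<^sup>+a. (\<integral>\<^sup>+u. ?k (dim A + ?m) (u + ?vB - (b + a)) * G (b + a)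
       \<partial>subspace_lborel A) \<partial>subspace_lborel A) \<partial>subspace_lborel B)"
    by (intro nn_integral_cong AA.Fubini') measurable
  also have "\<dots> = ?T"
  proof (rule nn_integral_cong_AE, rule AE_mp[OF AE_B], intro AE_I2 impI)
    fix b assume b: "b \<in> B \<and> b \<noteq> ?vB"
    have "(\<integral>\<^sup>+u. ?k (dim A + ?m) (u + ?vB - (b + a)) * G (b + a) \<partial>subspace_lborel A)
        = ?k ?m (?vB - b) * G (a + b)" if "a \<in> A" for a
    proof -
      have "(\<integral>\<^sup>+u. ?k (dim A + ?m) (u + ?vB - (b + a)) * G (b + a) \<partial>subspace_lborel A)
          = (\<integral>\<^sup>+u. ?k (dim A + ?m) (- a + u + (?vB - b)) \<partial>subspace_lborel A) * G (a + b)"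
        by (subst nn_integral_multc[symmetric]) (auto simp: algebra_simps)
      also have "(\<integral>\<^sup>+u. ?k (dim A + ?m) (- a + u + (?vB - b)) \<partial>subspace_lborel A) = ?k ?m (?vB - b)"
        using b that orth sub_B
        by (intro nn_integral_riesz_kernel_subspace A \<alpha>) (auto simp: subspace_neg[OF A])
      finally show ?thesis .
    qed
    then have "(\<integral>\<^sup>+a. (\<integral>\<^sup>+u. ?k (dim A + ?m) (u + ?vB - (b + a)) * G (b + a)
        \<partial>subspace_lborel A) \<partial>subspace_lborel A)
      = (\<integral>\<^sup>+a. ?k ?m (?vB - b) * G (a + b) \<partial>subspace_lborel A)"
      using AE_subspace_lborel_in[OF A] by (intro nn_integral_cong_AE) (auto elim!: eventually_mono)
    then show "(\<integral>\<^sup>+a. (\<integral>\<^sup>+u. ?k (dim A + ?m) (u + ?vB - (b + a)) * G (b + a)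
        \<partial>subspace_lborel A) \<partial>subspace_lborel A)
      = ?k ?m (?vB - b) * (\<integral>\<^sup>+a. G (a + b) \<partial>subspace_lborel A)"
      by (simp add: nn_integral_cmult)
  qed
  finally have L: "?L = ?T" .

  have "?R = (\<integral>\<^sup>+b. (\<integral>\<^sup>+c. ?k (dim Q + ?m) (v - (b + c)) *
      (\<integral>\<^sup>+a. G (a + proj B (b + c)) \<partial>subspace_lborel A) \<partial>subspace_lborel Q) \<partial>subspace_lborel B)"
    by (intro nn_integral_subspace_lborel_plus B Q QB) measurable
  also have "\<dots> = ?T"
  proof (rule nn_integral_cong_AE, rule AE_mp[OF AE_B], intro AE_I2 impI)
    fix b assume b: "b \<in> B \<and> b \<noteq> ?vB"
    have v_split: "v = ?vB + proj Q v"
      using proj_plus[OF B Q QB, of v] proj_self[OF subspace_plus[OF B Q QB] v] by simp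
    have "proj B (b + c) = b" if "c \<in> Q" for c
      using that b QB by (intro proj_eqI B) (auto simp: orth_comp_iff)
    then have "(\<integral>\<^sup>+c. ?k (dim Q + ?m) (v - (b + c)) *
        (\<integral>\<^sup>+a. G (a + proj B (b + c)) \<partial>subspace_lborel A) \<partial>subspace_lborel Q)
      = (\<integral>\<^sup>+c. ?k (dim Q + ?m) (v - (b + c)) *
        (\<integral>\<^sup>+a. G (a + b) \<partial>subspace_lborel A) \<partial>subspace_lborel Q)"
      using AE_subspace_lborel_in[OF Q] by (intro nn_integral_cong_AE) (auto elim!: eventually_mono)
    also have "\<dots> = (\<integral>\<^sup>+c. ?k (dim Q + ?m) (v - (b + c)) \<partial>subspace_lborel Q) *
        (\<integral>\<^sup>+a. G (a + b) \<partial>subspace_lborel A)"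
      by (rule nn_integral_multc) measurable
    also have "(\<integral>\<^sup>+c. ?k (dim Q + ?m) (v - (b + c)) \<partial>subspace_lborel Q)
        = (\<integral>\<^sup>+c. ?k (dim Q + ?m) (- proj Q v + c + (b - ?vB)) \<partial>subspace_lborel Q)"
    proof (rule nn_integral_cong)
      fix c
      have "v - (b + c) = - (- proj Q v + c + (b - ?vB))"
        by (subst v_split) (simp add: algebra_simps)
      then show "?k (dim Q + ?m) (v - (b + c)) = ?k (dim Q + ?m) (- proj Q v + c + (b - ?vB))"
        by (simp only: riesz_kernel_minus)
    qed
    also have "\<dots> = ?k ?m (b - ?vB)"
      using b orth sub_B proj_in[OF Q]
      by (intro nn_integral_riesz_kernel_subspace Q \<alpha>) (auto simp: subspace_neg[OF Q])
    also have "\<dots> = ?k ?m (?vB - b)"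
      using riesz_kernel_minus[of ?m \<alpha> "?vB - b"] by simp
    finally show "(\<integral>\<^sup>+c. ?k (dim Q + ?m) (v - (b + c)) *
        (\<integral>\<^sup>+a. G (a + proj B (b + c)) \<partial>subspace_lborel A) \<partial>subspace_lborel Q)
      = ?k ?m (?vB - b) * (\<integral>\<^sup>+a. G (a + b) \<partial>subspace_lborel A)" .
  qed
  finally show ?thesis using L by simp
qed

section \<open>Measurability on the Grassmannian\<close>

lemma grassmannianD:
  assumes "P \<in> grassmannian m X"
  shows "subspace P" "P \<subseteq> X" "dim P = m"
  using assms by (auto simp: grassmannian_def)

lemma space_grassmannian_borel: "space (grassmannian_borel m X) = grassmannian m X"
  by (simp add: grassmannian_borel_def)

lemma measurable_matrix:
  fixes f :: "'a \<Rightarrow> real ^ 'n \<Rightarrow> real ^ 'n"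
  assumes "\<And>x. (\<lambda>z. f z x) \<in> borel_measurable N"
  shows "(\<lambda>z. matrix (f z)) \<in> borel_measurable N"
proof -
  have "(\<lambda>z. matrix (f z) \<bullet> axis i (axis j 1)) \<in> borel_measurable N" for i j
  proof -
    have "(\<lambda>z. matrix (f z) \<bullet> axis i (axis j 1)) = (\<lambda>z. f z (axis j 1) \<bullet> axis i 1)"
      by (simp add: inner_axis matrix_def)
    then show ?thesis using assms by simp
  qed
  then show ?thesis
    by (subst borel_measurable_euclidean_space) (auto simp: Basis_vec_def)
qed

lemma measurable_grassmannian_borelI:
  assumes "\<And>z. z \<in> space N \<Longrightarrow> g z \<in> grassmannian m X"
    and "\<And>x. (\<lambda>z. proj (g z) x) \<in> borel_measurable N"
  shows "g \<in> measurable N (grassmannian_borel m X)"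
  unfolding grassmannian_borel_def
  using assms by (intro measurable_vimage_algebra2 measurable_matrix) auto

text \<open>
  The Borel structure makes the matrix of the projection measurable, and a matrix acts on vectors
continuously; so the projection is measurable in the subspace and the vector jointly.
\<close>

lemma measurable_proj_grassmannian[measurable (raw)]:
  fixes X :: "(real ^ 'n) set"
  assumes f: "f \<in> measurable N (grassmannian_borel m X)" and [measurable]: "g \<in> borel_measurable N"
  shows "(\<lambda>z. proj (f z) (g z)) \<in> borel_measurable N"
proof -
  have "(\<lambda>P. matrix (proj P)) \<in> borel_measurable (grassmannian_borel m X)"
    unfolding grassmannian_borel_def by (rule measurable_vimage_algebra1) simp
  from measurable_compose[OF f this]
  have [measurable]: "(\<lambda>z. matrix (proj (f z))) \<in> borel_measurable N" .
  have "continuous_on UNIV (\<lambda>p :: (real ^ 'n ^ 'n) \<times> (real ^ 'n). fst p *v snd p)"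
    unfolding matrix_vector_mult_def by (intro continuous_intros)
  then have mult: "(\<lambda>p :: (real ^ 'n ^ 'n) \<times> (real ^ 'n). fst p *v snd p) \<in> borel_measurable borel"
    by (rule borel_measurable_continuous_onI)
  have "(\<lambda>z. (matrix (proj (f z)), g z)) \<in> borel_measurable N"
    by (rule borel_measurable_Pair) measurable
  from measurable_compose[OF this mult]
  have "(\<lambda>z. matrix (proj (f z)) *v g z) \<in> borel_measurable N"
    by simp
  also have "?this \<longleftrightarrow> ?thesis"
    using measurable_space[OF f] 
    by (intro measurable_cong matrix_proj) (auto simp: space_grassmannian_borel dest: grassmannianD)
  finally show ?thesis .
qed

lemma grassmannian_orthogonal_image:
  assumes "orthogonal_transformation g" "g ` X = X" "P \<in> grassmannian m X"
  shows "g ` P \<in> grassmannian m X"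
proof -
  have lin: "linear g" and inj: "inj g"
    using assms(1) orthogonal_transformation_linear orthogonal_transformation_inj by auto
  have "dim (g ` P) = dim P"
    using lin inj by (intro dim_image_eq) (auto intro: inj_on_subset)
  then show ?thesis
    using grassmannianD[OF assms(3)] assms(2) linear_subspace_image[OF lin]
    by (auto simp: grassmannian_def)
qed

lemma measurable_image_grassmannian:
  fixes X :: "(real ^ 'n) set"
  assumes g: "orthogonal_transformation g" "g ` X = X"
  shows "(\<lambda>P. g ` P) \<in> measurable (grassmannian_borel m X) (grassmannian_borel m X)"
proof (rule measurable_grassmannian_borelI)
  note [measurable] = measurable_orthogonal_transformation[OF g(1)]
  fix x
  have "proj (g ` P) x = g (proj P (inv g x))" if "P \<in> grassmannian m X" for P
    using proj_orthogonal_image[OF grassmannianD(1)[OF that] g(1), of "inv g x"]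
      orthogonal_transformation_surj[OF g(1)] by (simp add: surj_f_inv_f)
  then have "(\<lambda>P. proj (g ` P) x) \<in> borel_measurable (grassmannian_borel m X)
      \<longleftrightarrow> (\<lambda>P. g (proj P (inv g x))) \<in> borel_measurable (grassmannian_borel m X)"
    by (intro measurable_cong) (simp add: space_grassmannian_borel)
  moreover have "(\<lambda>P. g (proj P (inv g x))) \<in> borel_measurable (grassmannian_borel m X)"
    by measurable
  ultimately show "(\<lambda>P. proj (g ` P) x) \<in> borel_measurable (grassmannian_borel m X)"
    by simp
qed (auto simp: space_grassmannian_borel grassmannian_orthogonal_image g)

section \<open>Existence of invariant measures on the Grassmannian\<close>

definition gaussian_measure :: "(real ^ 'n) measure" where
  "gaussian_measure = density lborel (\<lambda>x. ennreal (exp (- pi * (norm x)\<^sup>2)))"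

lemma sets_gaussian_measure[simp, measurable_cong]: "sets gaussian_measure = sets borel"
  and space_gaussian_measure[simp]: "space gaussian_measure = UNIV"
  by (simp_all add: gaussian_measure_def)

lemma prob_space_gaussian_measure: "prob_space (gaussian_measure :: (real ^ 'n) measure)"
proof
  let ?U = "UNIV :: (real ^ 'n) set"
  have "transverse_gaussian ?U x = 1" for x
    using proj_self[of ?U x] by (simp add: transverse_gaussian_def)
  then have "(\<integral>\<^sup>+x. ennreal (exp (- pi * (norm x)\<^sup>2)) \<partial>(lborel :: (real ^ 'n) measure))
      = (\<integral>\<^sup>+x. ennreal (exp (- pi * (norm x)\<^sup>2)) \<partial>subspace_lborel ?U)"
    using proj_self[of ?U] by (subst nn_integral_subspace_lborel) auto
  also have "\<dots> = 1"
    by (subst nn_integral_gaussian_subspace) auto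
  finally show "emeasure (gaussian_measure :: (real ^ 'n) measure) (space gaussian_measure) = 1"
    by (simp add: gaussian_measure_def emeasure_density)
qed

lemma distr_gaussian_measure:
  fixes g :: "real ^ 'n \<Rightarrow> real ^ 'n"
  assumes g: "orthogonal_transformation g"
  shows "distr gaussian_measure borel g = gaussian_measure"
proof (rule measure_eqI)
  note [measurable] = measurable_orthogonal_transformation[OF g]
  fix A assume "A \<in> sets (distr gaussian_measure borel g)"
  then have [measurable]: "A \<in> sets borel" by simp
  let ?e = "\<lambda>x :: real ^ 'n. ennreal (exp (- pi * (norm x)\<^sup>2))"
  have "emeasure (distr gaussian_measure borel g) A
      = (\<integral>\<^sup>+x. indicator A x \<partial>distr gaussian_measure borel g)"
    by simp
  also have "\<dots> = (\<integral>\<^sup>+x. ?e (g x) * indicator A (g x) \<partial>lborel)"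
    unfolding gaussian_measure_def orthogonal_transformation_norm[OF g]
    by (subst nn_integral_distr, measurable, subst nn_integral_density) auto
  also have "\<dots> = (\<integral>\<^sup>+x. ?e x * indicator A x \<partial>distr lborel borel g)"
    by (subst nn_integral_distr) auto
  also have "\<dots> = emeasure gaussian_measure A"
    unfolding distr_lborel_orthogonal_transformation[OF g] gaussian_measure_def
    by (subst emeasure_density) auto
  finally show "emeasure (distr gaussian_measure borel g) A = emeasure gaussian_measure A" .
qed simp

lemma AE_gaussian_measure_proj_neq_0:
  assumes Y: "subspace Y" "dim Y > 0"
  shows "AE x in gaussian_measure. proj Y x \<noteq> 0"
proof -
  note [measurable] = measurable_proj[OF Y(1)] measurable_transverse_gaussian[OF Y(1)]
  have "AE x in lborel. proj Y x \<noteq> 0"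
    using AE_subspace_lborel_neq[OF Y, of 0] unfolding subspace_lborel_eq[OF Y(1)]
    by (subst (asm) AE_distr_iff) (auto simp: AE_density transverse_gaussian_pos)
  then show ?thesis
    unfolding gaussian_measure_def by (subst AE_density) auto
qed

lemma proj_span_singleton:
  fixes y :: "real ^ 'n"
  assumes "y \<noteq> 0"
  shows "proj (span {y}) x = ((x \<bullet> y) / (y \<bullet> y)) *\<^sub>R y"
proof (rule proj_eqI[OF subspace_span])
  show "((x \<bullet> y) / (y \<bullet> y)) *\<^sub>R y \<in> span {y}"
    by (simp add: span_base span_scale)
  show "(x - ((x \<bullet> y) / (y \<bullet> y)) *\<^sub>R y) \<bullet> z = 0" if "z \<in> span {y}" for z
    using that assms by (auto simp: span_singleton inner_simps)
qed

text \<open>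
  Given a random m-dimensional P, take an independent Gaussian vector x, project it to the vector y in the
orthogonal complement of P in X, and pass to P + span {y}.  Almost surely y is not 0.  The construction
commutes with isometries that preserve X, and the law of the pair (P, x) is invariant under them, so the
law of the new subspace is invariant too.  Its projection is that of P plus the rank one projection along
y, which is measurable.
\<close>

lemma invariant_prob_on_grassmannian_Suc:
  fixes X :: "(real ^ 'n) set"
  assumes X: "subspace X" and m: "Suc m \<le> dim X" and M: "invariant_prob_on_grassmannian m X M"
  shows "\<exists>M'. invariant_prob_on_grassmannian (Suc m) X M'"
proof -
  interpret M: prob_space M
    using M by (simp add: invariant_prob_on_grassmannian_def)
  interpret G: prob_space "gaussian_measure :: (real ^ 'n) measure"
    by (rule prob_space_gaussian_measure)
  interpret pair_prob_space M "gaussian_measure :: (real ^ 'n) measure" ..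
  have sets_M[measurable_cong]: "sets M = sets (grassmannian_borel m X)"
    using M by (simp add: invariant_prob_on_grassmannian_def)
  then have space_M: "space M = grassmannian m X"
    by (metis sets_eq_imp_space_eq space_grassmannian_borel)
  note [measurable] = measurable_proj[OF X]
  let ?N = "M \<Otimes>\<^sub>M (gaussian_measure :: (real ^ 'n) measure)"
  obtain P0 where P0: "P0 \<in> grassmannian (Suc m) X"
  proof -
    obtain T where "subspace T" "T \<subseteq> span X" "dim T = Suc m"
      using choose_subspace_of_subspace[OF m] .
    then show thesis
      using X that[of T] by (simp add: grassmannian_def span_eq_iff[THEN iffD2])
  qed
  define y where "y = (\<lambda>(P, x). proj X x - proj P x)"
  \<comment> \<open>The value P0 on the null set where y vanishes only serves to land in the Grassmannian.\<close>
  define \<Phi> where "\<Phi> = (\<lambda>z. if y z = 0 then P0 else fst z + span {y z})"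
  have y_eq: "y (P, x) = proj (P\<^sup>\<bottom> \<inter> X) x" if "P \<in> grassmannian m X" for P x
    using proj_orth_comp_Int[OF grassmannianD(1)[OF that] X grassmannianD(2)[OF that]]
    by (simp add: y_def)
  have sub: "subspace (P\<^sup>\<bottom> \<inter> X)" for P
    by (simp add: subspace_inter subspace_orthogonal_comp X)
  have y_in: "y (P, x) \<in> P\<^sup>\<bottom> \<inter> X" if "P \<in> grassmannian m X" for P x
    using proj_in[OF sub[of P], of x] y_eq[OF that] by simp
  have span_y: "span {y (P, x)} \<subseteq> P\<^sup>\<bottom>" if "P \<in> grassmannian m X" for P x
    using y_in[OF that, of x] by (intro span_minimal subspace_orthogonal_comp) auto
  have y_meas[measurable]: "y \<in> borel_measurable ?N"
    unfolding y_def by measurable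
  have \<Phi>_in: "\<Phi> z \<in> grassmannian (Suc m) X" if "z \<in> space ?N" for z
  proof (cases "y z = 0")
    case False
    obtain P x where z: "z = (P, x)" and P: "P \<in> grassmannian m X"
      using \<open>z \<in> space ?N\<close> by (cases z) (auto simp: space_pair_measure space_M)
    note plus = subspace_plus[OF grassmannianD(1)[OF P] subspace_span span_y[OF P, of x]]
      dim_plus[OF grassmannianD(1)[OF P] subspace_span span_y[OF P, of x]]
    have "P + span {y (P, x)} \<subseteq> X"
      using y_in[OF P, of x] grassmannianD(2)[OF P] X
      by (auto simp: set_plus_def span_singleton intro!: subspace_add subspace_scale)
    then show ?thesis
      using plus False grassmannianD(3)[OF P] by (simp add: \<Phi>_def z grassmannian_def)
  qed (simp add: \<Phi>_def P0)
  have [measurable]: "\<Phi> \<in> measurable ?N (grassmannian_borel (Suc m) X)"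
  proof (rule measurable_grassmannian_borelI[OF \<Phi>_in])
    fix x
    have "proj (\<Phi> z) x = (if y z = 0 then proj P0 x
        else proj (fst z) x + ((x \<bullet> y z) / (y z \<bullet> y z)) *\<^sub>R y z)" if "z \<in> space ?N" for z
    proof -
      obtain P x' where z: "z = (P, x')" and P: "P \<in> grassmannian m X"
        using \<open>z \<in> space ?N\<close> by (cases z) (auto simp: space_pair_measure space_M)
      show ?thesis
        using proj_plus[OF grassmannianD(1)[OF P] subspace_span span_y[OF P, of x']]
        by (auto simp: \<Phi>_def z proj_span_singleton)
    qed
    then have "(\<lambda>z. proj (\<Phi> z) x) \<in> borel_measurable ?N \<longleftrightarrow> (\<lambda>z. if y z = 0 then proj P0 x
        else proj (fst z) x + ((x \<bullet> y z) / (y z \<bullet> y z)) *\<^sub>R y z) \<in> borel_measurable ?N"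
      by (rule measurable_cong)
    moreover have "(\<lambda>z. if y z = 0 then proj P0 x
        else proj (fst z) x + ((x \<bullet> y z) / (y z \<bullet> y z)) *\<^sub>R y z) \<in> borel_measurable ?N"
      by measurable
    ultimately show "(\<lambda>z. proj (\<Phi> z) x) \<in> borel_measurable ?N"
      by simp
  qed
  have AE_y: "AE z in ?N. y z \<noteq> 0"
  proof (rule AE_pair_measure)
    show "{z \<in> space ?N. y z \<noteq> 0} \<in> sets ?N" by measurable
    have "AE x in gaussian_measure. y (P, x) \<noteq> 0" if "P \<in> grassmannian m X" for P
    proof -
      have "dim (P\<^sup>\<bottom> \<inter> X) > 0"
        using dim_orth_comp_Int[OF grassmannianD(1)[OF that] X grassmannianD(2)[OF that]]
          grassmannianD(3)[OF that] m by simp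
      from AE_gaussian_measure_proj_neq_0[OF sub this] show ?thesis
        by (simp add: y_eq[OF that])
    qed
    then show "AE P in M. AE x in gaussian_measure. y (P, x) \<noteq> 0"
      by (rule AE_I2) (simp add: space_M)
  qed
  let ?M' = "distr ?N (grassmannian_borel (Suc m) X) \<Phi>"
  have "distr ?M' ?M' (\<lambda>P. g ` P) = ?M'" if g: "orthogonal_transformation g" "g ` X = X" for g
  proof -
    note [measurable] = measurable_image_grassmannian[OF g] measurable_orthogonal_transformation[OF g(1)]
    have lin: "linear g" and inj: "inj g"
      using g orthogonal_transformation_linear orthogonal_transformation_inj by auto
    let ?g = "\<lambda>(P, x). (g ` P, g x)"
    have equivariant: "g ` \<Phi> z = \<Phi> (?g z)" if z: "z \<in> space ?N" "y z \<noteq> 0" for z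
    proof -
      obtain P x where z_eq: "z = (P, x)" and P: "P \<in> grassmannian m X"
        using z by (cases z) (auto simp: space_pair_measure space_M)
      have "y (?g z) = g (y z)"
        using proj_orthogonal_image[OF X g(1), of x] proj_orthogonal_image[OF grassmannianD(1)[OF P] g(1), of x]
        by (simp add: y_def z_eq g(2) linear_diff[OF lin])
      moreover have "g (y z) \<noteq> 0"
        using z inj linear_0[OF lin] by (metis injD)
      moreover have "g ` (P + span {y z}) = g ` P + span {g (y z)}"
      proof -
        have "span {g (y z)} = g ` span {y z}"
          using span_linear_image[OF lin, of "{y z}"] by simp
        moreover have "g ` (P + S) = {g a + g b | a b. a \<in> P \<and> b \<in> S}" for S
          unfolding set_plus_def linear_add[OF lin, symmetric] by blast
        moreover have "g ` P + g ` S = {g a + g b | a b. a \<in> P \<and> b \<in> S}" for S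
          unfolding set_plus_def by blast
        ultimately show ?thesis by simp
      qed
      ultimately show ?thesis
        using z by (simp add: \<Phi>_def z_eq)
    qed
    have inv_N: "distr ?N ?N ?g = ?N"
    proof -
      have "distr M M (\<lambda>P. g ` P) = M"
        using M g by (simp add: invariant_prob_on_grassmannian_def)
      moreover have "distr gaussian_measure gaussian_measure g = gaussian_measure"
        using distr_gaussian_measure[OF g(1)] by (simp cong: distr_cong)
      ultimately show ?thesis
        using pair_measure_distr[of "\<lambda>P. g ` P" M M g gaussian_measure gaussian_measure]
          G.sigma_finite_measure by simp
    qed
    have "distr ?M' ?M' (\<lambda>P. g ` P) = distr ?N (grassmannian_borel (Suc m) X) (\<lambda>z. g ` \<Phi> z)"
      by (subst distr_distr) (auto simp: comp_def cong: distr_cong)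
    also have "\<dots> = distr ?N (grassmannian_borel (Suc m) X) (\<lambda>z. \<Phi> (?g z))"
    proof (rule distr_cong_AE[OF refl refl])
      show "AE z in ?N. g ` \<Phi> z = \<Phi> (?g z)"
        using AE_y AE_space[of ?N] by eventually_elim (rule equivariant)
    qed measurable
    also have "\<dots> = distr (distr ?N ?N ?g) (grassmannian_borel (Suc m) X) \<Phi>"
      by (subst distr_distr) (auto simp: comp_def)
    finally show ?thesis
      by (simp add: inv_N)
  qed
  then have "invariant_prob_on_grassmannian (Suc m) X ?M'"
    unfolding invariant_prob_on_grassmannian_def by (auto intro!: prob_space_distr)
  then show ?thesis ..
qed

text \<open>
  The induction starts with the point mass at {0}, written as the law of a constant.
\<close>

lemma invariant_prob_on_grassmannian_exists:
  fixes X :: "(real ^ 'n) set"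
  assumes X: "subspace X"
  shows "m \<le> dim X \<Longrightarrow> \<exists>M. invariant_prob_on_grassmannian m X M"
proof (induction m)
  case 0
  interpret G: prob_space "gaussian_measure :: (real ^ 'n) measure"
    by (rule prob_space_gaussian_measure)
  let ?M = "distr (gaussian_measure :: (real ^ 'n) measure) (grassmannian_borel 0 X) (\<lambda>_. {0})"
  have [measurable]: "(\<lambda>_. {0}) \<in> measurable (gaussian_measure :: (real ^ 'n) measure) (grassmannian_borel 0 X)"
    using X by (intro measurable_const) (auto simp: space_grassmannian_borel grassmannian_def subspace_0 subspace_def)
  have "distr ?M ?M (\<lambda>P. g ` P) = ?M" if g: "orthogonal_transformation g" "g ` X = X" for g
  proof -
    note [measurable] = measurable_image_grassmannian[OF g]
    have "distr ?M ?M (\<lambda>P. g ` P)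
        = distr (gaussian_measure :: (real ^ 'n) measure) (grassmannian_borel 0 X) (\<lambda>_. g ` {0})"
      by (subst distr_distr) (auto simp: comp_def cong: distr_cong)
    then show ?thesis
      using linear_0[OF orthogonal_transformation_linear[OF g(1)]] by simp
  qed
  then have "invariant_prob_on_grassmannian 0 X ?M"
    unfolding invariant_prob_on_grassmannian_def by (auto intro!: G.prob_space_distr)
  then show ?case ..
next
  case (Suc m)
  then show ?case
    using invariant_prob_on_grassmannian_Suc[OF X] by (metis Suc_leD)
qed

lemma
  fixes X :: "(real ^ 'n) set"
  assumes "subspace X" "m \<le> dim X"
  shows prob_space_grassmannian_measure: "prob_space (grassmannian_measure m X)"
    and sets_grassmannian_measure: "sets (grassmannian_measure m X) = sets (grassmannian_borel m X)"
    and space_grassmannian_measure: "space (grassmannian_measure m X) = grassmannian m X"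
proof -
  have "invariant_prob_on_grassmannian m X (grassmannian_measure m X)"
    unfolding grassmannian_measure_def
    using invariant_prob_on_grassmannian_exists[OF assms] by (rule someI_ex)
  then show "prob_space (grassmannian_measure m X)"
    and sets: "sets (grassmannian_measure m X) = sets (grassmannian_borel m X)"
    by (auto simp: invariant_prob_on_grassmannian_def)
  show "space (grassmannian_measure m X) = grassmannian m X"
    using sets_eq_imp_space_eq[OF sets] by (simp add: space_grassmannian_borel)
qed

section \<open>Planes as translates of subspaces\<close>

lemma
  fixes \<xi> :: "(real ^ 'n) set"
  assumes \<xi>: "subspace \<xi>"
  shows plane_dir_translate: "plane_dir ((+) x ` \<xi>) = \<xi>"
    and plane_foot_translate: "plane_foot ((+) x ` \<xi>) = x - proj \<xi> x"
    and translate_in_affine_grassmannian: "(+) x ` \<xi> \<in> affine_grassmannian (dim \<xi>)"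
proof -
  show dir: "plane_dir ((+) x ` \<xi>) = \<xi>"
  proof (intro set_eqI iffI)
    fix a assume "a \<in> \<xi>"
    then have "a = (x + a) - (x + 0)" "x + a \<in> (+) x ` \<xi>" "x + 0 \<in> (+) x ` \<xi>"
      using subspace_0[OF \<xi>] by auto
    then show "a \<in> plane_dir ((+) x ` \<xi>)"
      unfolding plane_dir_def by blast
  qed (auto simp: plane_dir_def subspace_diff[OF \<xi>])
  show "plane_foot ((+) x ` \<xi>) = x - proj \<xi> x"
    unfolding plane_foot_def dir
  proof (rule the_equality)
    have "x - proj \<xi> x = x + - proj \<xi> x" "- proj \<xi> x \<in> \<xi>"
      using proj_in[OF \<xi>] subspace_neg[OF \<xi>] by auto
    then show "x - proj \<xi> x \<in> (+) x ` \<xi> \<and> x - proj \<xi> x \<in> \<xi>\<^sup>\<bottom>"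
      using proj_orth[OF \<xi>] by (auto simp: orth_comp_iff image_iff)
    fix u assume u: "u \<in> (+) x ` \<xi> \<and> u \<in> \<xi>\<^sup>\<bottom>"
    then have "x - u \<in> \<xi>"
      using subspace_neg[OF \<xi>] by auto
    then have "proj \<xi> x = x - u"
      using u by (intro proj_eqI \<xi>) (auto simp: orth_comp_iff)
    then show "u = x - proj \<xi> x" by simp
  qed
  show "(+) x ` \<xi> \<in> affine_grassmannian (dim \<xi>)"
    using subspace_0[OF \<xi>] subspace_imp_affine[OF \<xi>]
    by (auto simp: affine_grassmannian_def affine_translation[symmetric] aff_dim_translation_eq aff_dim_subspace \<xi>)
qed

lemma translate_subspace_eq:
  assumes \<xi>: "subspace \<xi>" and "x - y \<in> \<xi>"
  shows "(+) x ` \<xi> = (+) y ` \<xi>"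
proof -
  have "x + a = y + ((x - y) + a)" "(x - y) + a \<in> \<xi>" "y + a = x + (a - (x - y))" "a - (x - y) \<in> \<xi>"
    if "a \<in> \<xi>" for a
    using assms that by (auto intro: subspace_add subspace_diff)
  then show ?thesis by (fastforce simp: image_iff)
qed

lemma measurable_affine_grassmannian_borelI:
  assumes "\<And>z. z \<in> space N \<Longrightarrow> subspace (\<xi> z) \<and> dim (\<xi> z) = j"
    and "\<And>x. (\<lambda>z. proj (\<xi> z) x) \<in> borel_measurable N"
    and "(\<lambda>z. x z - proj (\<xi> z) (x z)) \<in> borel_measurable N"
  shows "(\<lambda>z. (+) (x z) ` \<xi> z) \<in> measurable N (affine_grassmannian_borel j)"
  unfolding affine_grassmannian_borel_def
proof (rule measurable_vimage_algebra2)
  show "(\<lambda>z. (+) (x z) ` \<xi> z) \<in> space N \<rightarrow> affine_grassmannian j"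
    using assms(1) translate_in_affine_grassmannian by fastforce
  have "(\<lambda>z. (matrix (proj (\<xi> z)), x z - proj (\<xi> z) (x z))) \<in> borel_measurable N"
    using assms(2,3) by (intro borel_measurable_Pair measurable_matrix)
  also have "?this \<longleftrightarrow> (\<lambda>z. (matrix (proj (plane_dir ((+) (x z) ` \<xi> z))), plane_foot ((+) (x z) ` \<xi> z)))
      \<in> borel_measurable N"
    using assms(1) by (intro measurable_cong) (simp add: plane_dir_translate plane_foot_translate)
  finally show "(\<lambda>z. (matrix (proj (plane_dir ((+) (x z) ` \<xi> z))), plane_foot ((+) (x z) ` \<xi> z)))
      \<in> borel_measurable N" .
qed

section \<open>Fourfold iterated integrals\<close>

lemma nn_integral_iterated4:
  fixes H :: "'a \<times> 'b \<times> 'c \<times> 'd \<Rightarrow> ennreal"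
  assumes "sigma_finite_measure B" "sigma_finite_measure C" "sigma_finite_measure D"
    and [measurable]: "H \<in> borel_measurable (A \<Otimes>\<^sub>M (B \<Otimes>\<^sub>M (C \<Otimes>\<^sub>M D)))"
  shows "(\<integral>\<^sup>+z. H z \<partial>(A \<Otimes>\<^sub>M (B \<Otimes>\<^sub>M (C \<Otimes>\<^sub>M D))))
       = (\<integral>\<^sup>+a. \<integral>\<^sup>+b. \<integral>\<^sup>+c. \<integral>\<^sup>+d. H (a, b, c, d) \<partial>D \<partial>C \<partial>B \<partial>A)"
proof -
  interpret B: sigma_finite_measure B by fact
  interpret C: sigma_finite_measure C by fact
  interpret D: sigma_finite_measure D by fact
  interpret CD: pair_sigma_finite C D ..
  interpret CD: sigma_finite_measure "C \<Otimes>\<^sub>M D" by (rule CD.sigma_finite_measure_axioms)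
  interpret BCD: pair_sigma_finite B "C \<Otimes>\<^sub>M D" ..
  interpret BCD: sigma_finite_measure "B \<Otimes>\<^sub>M (C \<Otimes>\<^sub>M D)" by (rule BCD.sigma_finite_measure_axioms)
  have "(\<integral>\<^sup>+z. H z \<partial>(A \<Otimes>\<^sub>M (B \<Otimes>\<^sub>M (C \<Otimes>\<^sub>M D))))
      = (\<integral>\<^sup>+a. \<integral>\<^sup>+r. H (a, r) \<partial>(B \<Otimes>\<^sub>M (C \<Otimes>\<^sub>M D)) \<partial>A)"
    by (rule BCD.nn_integral_fst[symmetric]) measurable
  also have "\<dots> = (\<integral>\<^sup>+a. \<integral>\<^sup>+b. \<integral>\<^sup>+r. H (a, b, r) \<partial>(C \<Otimes>\<^sub>M D) \<partial>B \<partial>A)"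
    by (intro nn_integral_cong CD.nn_integral_fst[symmetric]) measurable
  also have "\<dots> = (\<integral>\<^sup>+a. \<integral>\<^sup>+b. \<integral>\<^sup>+c. \<integral>\<^sup>+d. H (a, b, c, d) \<partial>D \<partial>C \<partial>B \<partial>A)"
    by (intro nn_integral_cong D.nn_integral_fst[symmetric]) measurable
  finally show ?thesis .
qed

text \<open>
  The inner integrals may fail to exist on null sets, where the Bochner integral has the value 0; so the
equalities between the partially iterated integrals hold almost everywhere only.
\<close>

lemma integral_iterated4:
  fixes H :: "'a \<times> 'b \<times> 'c \<times> 'd \<Rightarrow> 'e::{banach, second_countable_topology}"
  assumes "sigma_finite_measure A" "sigma_finite_measure B" "sigma_finite_measure C" "sigma_finite_measure D"
    and H: "integrable (A \<Otimes>\<^sub>M (B \<Otimes>\<^sub>M (C \<Otimes>\<^sub>M D))) H"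
  shows "(LINT z|(A \<Otimes>\<^sub>M (B \<Otimes>\<^sub>M (C \<Otimes>\<^sub>M D))). H z)
       = (LINT a|A. LINT b|B. LINT c|C. LINT d|D. H (a, b, c, d))"
proof -
  interpret A: sigma_finite_measure A by fact
  interpret B: sigma_finite_measure B by fact
  interpret C: sigma_finite_measure C by fact
  interpret D: sigma_finite_measure D by fact
  interpret CD: pair_sigma_finite C D ..
  interpret CDs: sigma_finite_measure "C \<Otimes>\<^sub>M D" by (rule CD.sigma_finite_measure_axioms)
  interpret BCD: pair_sigma_finite B "C \<Otimes>\<^sub>M D" ..
  interpret BCDs: sigma_finite_measure "B \<Otimes>\<^sub>M (C \<Otimes>\<^sub>M D)" by (rule BCD.sigma_finite_measure_axioms)
  interpret ABCD: pair_sigma_finite A "B \<Otimes>\<^sub>M (C \<Otimes>\<^sub>M D)" ..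
  have [measurable]: "H \<in> borel_measurable (A \<Otimes>\<^sub>M (B \<Otimes>\<^sub>M (C \<Otimes>\<^sub>M D)))"
    using H by (rule borel_measurable_integrable)
  have inner: "(LINT r|(B \<Otimes>\<^sub>M (C \<Otimes>\<^sub>M D)). H (a, r)) = (LINT b|B. LINT c|C. LINT d|D. H (a, b, c, d))"
    if a[measurable]: "a \<in> space A" and int: "integrable (B \<Otimes>\<^sub>M (C \<Otimes>\<^sub>M D)) (\<lambda>r. H (a, r))" for a
  proof -
    have "(LINT r|(C \<Otimes>\<^sub>M D). H (a, b, r)) = (LINT c|C. LINT d|D. H (a, b, c, d))"
      if "integrable (C \<Otimes>\<^sub>M D) (\<lambda>r. H (a, b, r))" for b
      using CD.integral_fst'[OF that] by simp
    then have "AE b in B. (LINT r|(C \<Otimes>\<^sub>M D). H (a, b, r)) = (LINT c|C. LINT d|D. H (a, b, c, d))"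
      using BCD.AE_integrable_fst'[OF int] by (auto elim!: eventually_mono)
    then have "(LINT b|B. LINT r|(C \<Otimes>\<^sub>M D). H (a, b, r)) = (LINT b|B. LINT c|C. LINT d|D. H (a, b, c, d))"
      by (intro integral_cong_AE) measurable
    then show ?thesis
      using BCD.integral_fst'[OF int] by simp
  qed
  have "AE a in A. (LINT r|(B \<Otimes>\<^sub>M (C \<Otimes>\<^sub>M D)). H (a, r)) = (LINT b|B. LINT c|C. LINT d|D. H (a, b, c, d))"
    using AE_space[of A] ABCD.AE_integrable_fst'[OF H] by eventually_elim (rule inner)
  then have "(LINT a|A. LINT r|(B \<Otimes>\<^sub>M (C \<Otimes>\<^sub>M D)). H (a, r))
      = (LINT a|A. LINT b|B. LINT c|C. LINT d|D. H (a, b, c, d))"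
    by (intro integral_cong_AE) measurable
  then show ?thesis
    using ABCD.integral_fst'[OF H] by simp
qed

section \<open>The two transforms on translates\<close>

lemma measurable_translate:
  assumes "subspace \<xi>"
  shows "(\<lambda>w. (+) w ` \<xi>) \<in> measurable borel (affine_grassmannian_borel (dim \<xi>))"
  using assms by (intro measurable_affine_grassmannian_borelI) (auto intro!: measurable_proj borel_measurable_diff)

lemma riesz_potential_nn_translate:
  fixes \<xi> :: "(real ^ 'n) set"
  assumes \<xi>: "subspace \<xi>" and \<alpha>: "0 < \<alpha>" "\<alpha> < real d"
    and [measurable]: "(\<lambda>w. \<phi> ((+) w ` \<xi>)) \<in> borel_measurable borel"
  shows "riesz_potential_nn d \<alpha> \<phi> ((+) x ` \<xi>)
       = (\<integral>\<^sup>+w. ennreal (riesz_kernel d \<alpha> (x - proj \<xi> x - w)) * \<phi> ((+) w ` \<xi>) \<partial>subspace_lborel (\<xi>\<^sup>\<bottom>))"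
proof -
  have pos: "riesz_gamma d \<alpha> > 0"
    by (rule riesz_gamma_pos[OF \<alpha>])
  have "riesz_potential_nn d \<alpha> \<phi> ((+) x ` \<xi>)
      = (\<integral>\<^sup>+w. ennreal (1 / riesz_gamma d \<alpha>) * (ennreal (1 / norm (x - proj \<xi> x - w) powr (real d - \<alpha>)) *
           \<phi> ((+) w ` \<xi>)) \<partial>subspace_lborel (\<xi>\<^sup>\<bottom>))"
    by (simp add: riesz_potential_nn_def plane_dir_translate plane_foot_translate \<xi> nn_integral_cmult)
  also have "\<dots> = (\<integral>\<^sup>+w. ennreal (riesz_kernel d \<alpha> (x - proj \<xi> x - w)) * \<phi> ((+) w ` \<xi>) \<partial>subspace_lborel (\<xi>\<^sup>\<bottom>))"
    unfolding riesz_kernel_def mult.assoc[symmetric]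
    using pos by (intro nn_integral_cong) (subst ennreal_mult[symmetric], auto)
  finally show ?thesis .
qed

lemma riesz_potential_translate:
  fixes \<xi> :: "(real ^ 'n) set" and \<phi> :: "(real ^ 'n) set \<Rightarrow> 'b::{banach, second_countable_topology}"
  assumes \<xi>: "subspace \<xi>"
  shows "riesz_potential d \<alpha> \<phi> ((+) x ` \<xi>)
       = (LINT w|subspace_lborel (\<xi>\<^sup>\<bottom>). riesz_kernel d \<alpha> (x - proj \<xi> x - w) *\<^sub>R \<phi> ((+) w ` \<xi>))"
  unfolding riesz_potential_def Let_def plane_dir_translate[OF \<xi>] plane_foot_translate[OF \<xi>]
    riesz_kernel_def scaleR_scaleR[symmetric] integral_scaleR_right ..

lemma strichartz_transform_nn_translate:
  assumes "subspace \<eta>"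
  shows "strichartz_transform_nn p q \<phi> ((+) x ` \<eta>)
       = (\<integral>\<^sup>+Q. \<integral>\<^sup>+P. \<integral>\<^sup>+u. \<phi> ((+) (u + (x - proj \<eta> x)) ` (P + Q))
           \<partial>subspace_lborel (P\<^sup>\<bottom> \<inter> \<eta>) \<partial>grassmannian_measure p \<eta>
           \<partial>grassmannian_measure q (\<eta>\<^sup>\<bottom>))"
  by (simp add: strichartz_transform_nn_def plane_dir_translate plane_foot_translate assms)

lemma strichartz_transform_translate:
  fixes \<phi> :: "(real ^ 'n) set \<Rightarrow> 'b::{banach, second_countable_topology}"
  assumes "subspace \<eta>"
  shows "strichartz_transform p q \<phi> ((+) x ` \<eta>)
       = (LINT Q|grassmannian_measure q (\<eta>\<^sup>\<bottom>). LINT P|grassmannian_measure p \<eta>.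
           LINT u|subspace_lborel (P\<^sup>\<bottom> \<inter> \<eta>). \<phi> ((+) (u + (x - proj \<eta> x)) ` (P + Q)))"
  by (simp add: strichartz_transform_def plane_dir_translate plane_foot_translate assms)

lemma orth_comp_Int_plus:
  fixes X Y :: "(real ^ 'n) set"
  assumes "subspace X" "subspace Y" "X \<subseteq> Y"
  shows "(X\<^sup>\<bottom> \<inter> Y) + X = Y"
proof (intro set_eqI iffI)
  fix x assume "x \<in> Y"
  have "x - proj X x \<in> Y"
    using proj_in[OF assms(1), of x] assms(3) by (intro subspace_diff assms(2) \<open>x \<in> Y\<close>) blast
  then have "x - proj X x \<in> X\<^sup>\<bottom> \<inter> Y"
    using proj_orth[OF assms(1)] by (auto simp: orth_comp_iff)
  then have "(x - proj X x) + proj X x \<in> (X\<^sup>\<bottom> \<inter> Y) + X"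
    by (intro set_plus_intro proj_in assms)
  then show "x \<in> (X\<^sup>\<bottom> \<inter> Y) + X" by simp
next
  fix x assume "x \<in> (X\<^sup>\<bottom> \<inter> Y) + X"
  then show "x \<in> Y"
    using assms by (auto simp: set_plus_def intro: subspace_add)
qed

section \<open>The subspaces attached to a pair of directions\<close>

text \<open>
  The remaining dimension m = n - k - q is the dimension of the orthogonal complement of Q in
\<^term>\<open>\<eta>\<^sup>\<bottom>\<close>, in which the collapsed Riesz kernel lives.  In these terms the j-planes have
codimension l + m and the k-planes have codimension q + m.
\<close>

locale strichartz_setting =
  fixes \<eta> :: "(real ^ 'n) set" and v :: "real ^ 'n" and p q l m :: nat and \<alpha> :: real
  assumes \<eta>_in: "\<eta> \<in> grassmannian (p + l) UNIV"
    and dims: "p + l + q + m = CARD('n)"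
    and v: "v \<in> \<eta>\<^sup>\<bottom>"
    and \<alpha>: "0 < \<alpha>" "\<alpha> < real m"
begin

lemma \<eta>: "subspace \<eta>" "dim \<eta> = p + l"
  using grassmannianD[OF \<eta>_in] by auto

lemma \<eta>_perp: "subspace (\<eta>\<^sup>\<bottom>)" "dim (\<eta>\<^sup>\<bottom>) = q + m"
  using dim_orth_comp_Int[OF \<eta>(1) subspace_UNIV subset_UNIV] \<eta>(2) dims
  by (auto simp: subspace_orthogonal_comp)

abbreviation "MP \<equiv> grassmannian_measure p \<eta>"
abbreviation "MQ \<equiv> grassmannian_measure q (\<eta>\<^sup>\<bottom>)"

sublocale MP: prob_space MP
  by (rule prob_space_grassmannian_measure) (simp_all add: \<eta>)

sublocale MQ: prob_space MQ
  by (rule prob_space_grassmannian_measure) (simp_all add: \<eta>_perp)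

lemma sets_MP[measurable_cong]: "sets MP = sets (grassmannian_borel p \<eta>)"
  by (rule sets_grassmannian_measure) (simp_all add: \<eta>)

lemma sets_MQ[measurable_cong]: "sets MQ = sets (grassmannian_borel q (\<eta>\<^sup>\<bottom>))"
  by (rule sets_grassmannian_measure) (simp_all add: \<eta>_perp)

lemma space_MP: "space MP = grassmannian p \<eta>"
  by (rule space_grassmannian_measure) (simp_all add: \<eta>)

lemma space_MQ: "space MQ = grassmannian q (\<eta>\<^sup>\<bottom>)"
  by (rule space_grassmannian_measure) (simp_all add: \<eta>_perp)

lemma measurable_proj_\<eta>[measurable]: "proj \<eta> \<in> borel_measurable borel"
  by (rule measurable_proj[OF \<eta>(1)])

text \<open>
  These are the projections onto \<^term>\<open>P\<^sup>\<bottom> \<inter> \<eta>\<close> and \<^term>\<open>(P + Q)\<^sup>\<bottom>\<close>, expressed by projections onto P, Q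
and \<eta>, so that their joint measurability in P, Q and x is evident.
\<close>

definition proj_fiber :: "(real ^ 'n) set \<Rightarrow> real ^ 'n \<Rightarrow> real ^ 'n" where
  "proj_fiber P x = proj \<eta> x - proj P x"

definition proj_perp :: "(real ^ 'n) set \<Rightarrow> (real ^ 'n) set \<Rightarrow> real ^ 'n \<Rightarrow> real ^ 'n" where
  "proj_perp Q P x = x - (proj P x + proj Q x)"

lemma fiber_subspace:
  assumes P: "P \<in> grassmannian p \<eta>"
  shows "subspace (P\<^sup>\<bottom> \<inter> \<eta>)" "dim (P\<^sup>\<bottom> \<inter> \<eta>) = l" "proj (P\<^sup>\<bottom> \<inter> \<eta>) = proj_fiber P"
proof -
  show "subspace (P\<^sup>\<bottom> \<inter> \<eta>)"
    by (simp add: subspace_inter subspace_orthogonal_comp \<eta>)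
  show "dim (P\<^sup>\<bottom> \<inter> \<eta>) = l" "proj (P\<^sup>\<bottom> \<inter> \<eta>) = proj_fiber P"
    using dim_orth_comp_Int[OF grassmannianD(1)[OF P] \<eta>(1) grassmannianD(2)[OF P]]
      proj_orth_comp_Int[OF grassmannianD(1)[OF P] \<eta>(1) grassmannianD(2)[OF P]]
      \<eta>(2) grassmannianD(3)[OF P] by (auto simp: proj_fiber_def fun_eq_iff)
qed

text \<open>
  The part of \<^term>\<open>\<eta>\<^sup>\<bottom>\<close> along which neither transform can integrate out the kernel.
\<close>

lemma residual_subspace:
  assumes Q: "Q \<in> grassmannian q (\<eta>\<^sup>\<bottom>)"
  shows "subspace (Q\<^sup>\<bottom> \<inter> \<eta>\<^sup>\<bottom>)" "dim (Q\<^sup>\<bottom> \<inter> \<eta>\<^sup>\<bottom>) = m"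
    "proj (Q\<^sup>\<bottom> \<inter> \<eta>\<^sup>\<bottom>) x = x - proj \<eta> x - proj Q x"
    "(Q\<^sup>\<bottom> \<inter> \<eta>\<^sup>\<bottom>) + Q = \<eta>\<^sup>\<bottom>"
proof -
  show "subspace (Q\<^sup>\<bottom> \<inter> \<eta>\<^sup>\<bottom>)"
    by (simp add: subspace_inter subspace_orthogonal_comp)
  show "dim (Q\<^sup>\<bottom> \<inter> \<eta>\<^sup>\<bottom>) = m" "proj (Q\<^sup>\<bottom> \<inter> \<eta>\<^sup>\<bottom>) x = x - proj \<eta> x - proj Q x"
    using dim_orth_comp_Int[OF grassmannianD(1)[OF Q] \<eta>_perp(1) grassmannianD(2)[OF Q]]
      proj_orth_comp_Int[OF grassmannianD(1)[OF Q] \<eta>_perp(1) grassmannianD(2)[OF Q]]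
      \<eta>_perp(2) grassmannianD(3)[OF Q] by (auto simp: proj_orth_comp[OF \<eta>(1)])
  show "(Q\<^sup>\<bottom> \<inter> \<eta>\<^sup>\<bottom>) + Q = \<eta>\<^sup>\<bottom>"
    by (rule orth_comp_Int_plus[OF grassmannianD(1)[OF Q] \<eta>_perp(1) grassmannianD(2)[OF Q]])
qed

lemma sum_direction:
  assumes P: "P \<in> grassmannian p \<eta>" and Q: "Q \<in> grassmannian q (\<eta>\<^sup>\<bottom>)"
  shows "subspace (P + Q)" "dim (P + Q) = p + q" "proj (P + Q) x = proj P x + proj Q x"
    "proj ((P + Q)\<^sup>\<bottom>) x = proj_perp Q P x"
    "(P + Q)\<^sup>\<bottom> = (Q\<^sup>\<bottom> \<inter> \<eta>\<^sup>\<bottom>) + (P\<^sup>\<bottom> \<inter> \<eta>)"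
proof -
  note gP = grassmannianD[OF P] and gQ = grassmannianD[OF Q]
  have QP: "Q \<subseteq> P\<^sup>\<bottom>"
    using gP(2) gQ(2) orthogonal_comp_anti_mono by blast
  show sub: "subspace (P + Q)" and "dim (P + Q) = p + q"
    and proj_PQ: "\<And>x. proj (P + Q) x = proj P x + proj Q x"
    using subspace_plus[OF gP(1) gQ(1) QP] dim_plus[OF gP(1) gQ(1) QP] proj_plus[OF gP(1) gQ(1) QP]
      gP(3) gQ(3) by auto
  show "proj ((P + Q)\<^sup>\<bottom>) x = proj_perp Q P x"
    by (simp add: proj_orth_comp[OF sub] proj_PQ proj_perp_def)
  show "(P + Q)\<^sup>\<bottom> = (Q\<^sup>\<bottom> \<inter> \<eta>\<^sup>\<bottom>) + (P\<^sup>\<bottom> \<inter> \<eta>)"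
  proof (intro set_eqI iffI)
    fix x assume x: "x \<in> (P + Q)\<^sup>\<bottom>"
    have xP: "x \<bullet> y = 0" if "y \<in> P" for y
      using x that subspace_0[OF gQ(1)] set_plus_intro[of y P 0 Q] by (auto simp: orth_comp_iff)
    have xQ: "x \<bullet> y = 0" if "y \<in> Q" for y
      using x that subspace_0[OF gP(1)] set_plus_intro[of 0 P y Q] by (auto simp: orth_comp_iff)
    have "proj \<eta> x \<bullet> y = 0" if "y \<in> P" for y
      using proj_orth[OF \<eta>(1), of y x] xP[OF that] gP(2) that by (auto simp: inner_simps)
    then have a: "proj \<eta> x \<in> P\<^sup>\<bottom> \<inter> \<eta>"
      using proj_in[OF \<eta>(1)] by (auto simp: orth_comp_iff)
    have "x - proj \<eta> x \<in> \<eta>\<^sup>\<bottom>"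
      using proj_orth[OF \<eta>(1)] by (auto simp: orth_comp_iff)
    moreover have "(x - proj \<eta> x) \<bullet> y = 0" if "y \<in> Q" for y
    proof -
      have "y \<bullet> proj \<eta> x = 0"
        using gQ(2) that proj_in[OF \<eta>(1), of x] by (auto simp: orth_comp_iff)
      then show ?thesis
        using xQ[OF that] by (simp add: inner_simps inner_commute)
    qed
    ultimately have b: "x - proj \<eta> x \<in> Q\<^sup>\<bottom> \<inter> \<eta>\<^sup>\<bottom>"
      by (auto simp: orth_comp_iff)
    show "x \<in> (Q\<^sup>\<bottom> \<inter> \<eta>\<^sup>\<bottom>) + (P\<^sup>\<bottom> \<inter> \<eta>)"
      using set_plus_intro[OF b a] by simp
  next
    fix x assume "x \<in> (Q\<^sup>\<bottom> \<inter> \<eta>\<^sup>\<bottom>) + (P\<^sup>\<bottom> \<inter> \<eta>)"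
    then obtain b a where x: "x = b + a" and b: "b \<in> Q\<^sup>\<bottom>" "b \<in> \<eta>\<^sup>\<bottom>" and a: "a \<in> P\<^sup>\<bottom>" "a \<in> \<eta>"
      by (auto simp: set_plus_def)
    have "x \<bullet> (y + z) = 0" if "y \<in> P" "z \<in> Q" for y z
    proof -
      have "b \<bullet> y = 0" "b \<bullet> z = 0" "a \<bullet> y = 0" "a \<bullet> z = 0"
        using that a b gP(2) gQ(2) by (auto simp: orth_comp_iff inner_commute[of a z] subset_iff)
      then show ?thesis by (simp add: x inner_simps)
    qed
    then show "x \<in> (P + Q)\<^sup>\<bottom>"
      by (auto simp: orth_comp_iff set_plus_def)
  qed
qed

end

context strichartz_setting
begin

section \<open>The incidence measures\<close>

text \<open>
  The transverse Gaussian weights of \<^term>\<open>P\<^sup>\<bottom> \<inter> \<eta>\<close>, \<^term>\<open>(P + Q)\<^sup>\<bottom>\<close> and \<^term>\<open>\<eta>\<^sup>\<bottom>\<close>, again as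
functions that are measurable in the directions as well.
\<close>

definition weight_fiber :: "(real ^ 'n) set \<Rightarrow> real ^ 'n \<Rightarrow> real" where
  "weight_fiber P x = exp (- pi * (norm (x - proj_fiber P x))\<^sup>2)"

definition weight_perp :: "(real ^ 'n) set \<Rightarrow> (real ^ 'n) set \<Rightarrow> real ^ 'n \<Rightarrow> real" where
  "weight_perp Q P x = exp (- pi * (norm (x - proj_perp Q P x))\<^sup>2)"

definition proj_\<eta>_perp :: "real ^ 'n \<Rightarrow> real ^ 'n" where
  "proj_\<eta>_perp x = x - proj \<eta> x"

definition weight_\<eta>_perp :: "real ^ 'n \<Rightarrow> real" where
  "weight_\<eta>_perp x = exp (- pi * (norm (x - proj_\<eta>_perp x))\<^sup>2)"

lemma weight_fiber: "P \<in> grassmannian p \<eta> \<Longrightarrow> transverse_gaussian (P\<^sup>\<bottom> \<inter> \<eta>) = weight_fiber P"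
  by (auto simp: transverse_gaussian_def weight_fiber_def fiber_subspace(3))

lemma weight_perp:
  "P \<in> grassmannian p \<eta> \<Longrightarrow> Q \<in> grassmannian q (\<eta>\<^sup>\<bottom>)
    \<Longrightarrow> transverse_gaussian ((P + Q)\<^sup>\<bottom>) = weight_perp Q P"
  by (auto simp: transverse_gaussian_def weight_perp_def sum_direction(4))

lemma proj_\<eta>_perp: "proj (\<eta>\<^sup>\<bottom>) = proj_\<eta>_perp"
  by (auto simp: proj_orth_comp[OF \<eta>(1)] proj_\<eta>_perp_def)

lemma weight_\<eta>_perp: "transverse_gaussian (\<eta>\<^sup>\<bottom>) = weight_\<eta>_perp"
  by (auto simp: transverse_gaussian_def weight_\<eta>_perp_def proj_\<eta>_perp)

lemma weight_nonneg: "weight_fiber P x \<ge> 0" "weight_perp Q P x \<ge> 0" "weight_\<eta>_perp x \<ge> 0"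
  by (auto simp: weight_fiber_def weight_perp_def weight_\<eta>_perp_def)

lemma measurable_proj_fiber[measurable (raw)]:
  assumes [measurable]: "f \<in> measurable M (grassmannian_borel p \<eta>)" "g \<in> borel_measurable M"
  shows "(\<lambda>z. proj_fiber (f z) (g z)) \<in> borel_measurable M"
    and "(\<lambda>z. weight_fiber (f z) (g z)) \<in> borel_measurable M"
  unfolding weight_fiber_def proj_fiber_def by measurable

lemma measurable_proj_perp[measurable (raw)]:
  assumes [measurable]: "f \<in> measurable M (grassmannian_borel p \<eta>)" "h \<in> measurable M (grassmannian_borel q (\<eta>\<^sup>\<bottom>))"
    "g \<in> borel_measurable M"
  shows "(\<lambda>z. proj_perp (h z) (f z) (g z)) \<in> borel_measurable M"
    and "(\<lambda>z. weight_perp (h z) (f z) (g z)) \<in> borel_measurable M"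
  unfolding weight_perp_def proj_perp_def by measurable

lemma measurable_proj_\<eta>_perp[measurable]:
  "proj_\<eta>_perp \<in> borel_measurable borel" "weight_\<eta>_perp \<in> borel_measurable borel"
  unfolding weight_\<eta>_perp_def[abs_def] proj_\<eta>_perp_def[abs_def] by measurable

abbreviation "MN \<equiv> MQ \<Otimes>\<^sub>M (MP \<Otimes>\<^sub>M (borel :: (real ^ 'n) measure))"
abbreviation "ML \<equiv> MQ \<Otimes>\<^sub>M (MP \<Otimes>\<^sub>M ((lborel :: (real ^ 'n) measure) \<Otimes>\<^sub>M (lborel :: (real ^ 'n) measure)))"
abbreviation "MR \<equiv> (lborel :: (real ^ 'n) measure) \<Otimes>\<^sub>M (MQ \<Otimes>\<^sub>M (MP \<Otimes>\<^sub>M (lborel :: (real ^ 'n) measure)))"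

text \<open>
  The densities that appear when the two sides of the identity are written as integrals over the
parameters (Q, P, x, y) and (y, Q, P, x), in the order of integration of either side: the product of
the Riesz kernel with the Gaussian weights of the two subspaces over which that side integrates.
\<close>

definition "kernel_L = (\<lambda>(Q, P, x, y). weight_fiber P x *
   (weight_perp Q P y * riesz_kernel (l + m) \<alpha> (proj_fiber P x + (v - proj Q v) - proj_perp Q P y)))"

definition "kernel_R = (\<lambda>(y, Q, P, x). weight_\<eta>_perp y * (riesz_kernel (q + m) \<alpha> (v - proj_\<eta>_perp y) * weight_fiber P x))"

text \<open>
  The directions and one point of the plane at which f is evaluated.  The point is moved inside its plane
so that it is orthogonal to P + Q; otherwise the two image measures would differ.
\<close>

definition "param_L = (\<lambda>(Q, P, x :: real ^ 'n, y). (Q, P, proj_perp Q P y))"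

definition "param_R = (\<lambda>(y, Q, P, x). (Q, P, proj_fiber P x + (proj_\<eta>_perp y - proj Q y)))"

lemma measurable_kernels[measurable]:
  "kernel_L \<in> borel_measurable ML" "kernel_R \<in> borel_measurable MR"
  "param_L \<in> measurable ML MN" "param_R \<in> measurable MR MN"
  unfolding kernel_L_def kernel_R_def param_L_def param_R_def by measurable

lemma kernel_nonneg: "kernel_L z \<ge> 0" "kernel_R z' \<ge> 0"
  using \<alpha> weight_nonneg
  by (auto simp: kernel_L_def kernel_R_def split_beta intro!: mult_nonneg_nonneg riesz_kernel_nonneg)

text \<open>
  This is \<open>riesz_kernel_identity\<close> with A the subspace \<^term>\<open>P\<^sup>\<bottom> \<inter> \<eta>\<close> and B the subspace
\<^term>\<open>Q\<^sup>\<bottom> \<inter> \<eta>\<^sup>\<bottom>\<close>, after the Gaussian representation of all four integrals.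
\<close>

lemma nn_integral_fixed_directions:
  assumes P: "P \<in> grassmannian p \<eta>" and Q: "Q \<in> grassmannian q (\<eta>\<^sup>\<bottom>)"
    and [measurable]: "G \<in> borel_measurable borel"
  shows "(\<integral>\<^sup>+x. \<integral>\<^sup>+y. ennreal (kernel_L (Q, P, x, y)) * G (proj_perp Q P y) \<partial>lborel \<partial>lborel)
       = (\<integral>\<^sup>+y. \<integral>\<^sup>+x. ennreal (kernel_R (y, Q, P, x)) *
           G (proj_fiber P x + (proj_\<eta>_perp y - proj Q y)) \<partial>lborel \<partial>lborel)"
proof -
  note A = fiber_subspace[OF P] and B = residual_subspace[OF Q] and PQ = sum_direction[OF P Q]
  note Q' = grassmannianD[OF Q] and P' = grassmannianD[OF P]
  let ?A = "P\<^sup>\<bottom> \<inter> \<eta>" and ?B = "Q\<^sup>\<bottom> \<inter> \<eta>\<^sup>\<bottom>"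
  note [measurable] = measurable_proj[OF Q'(1)] measurable_proj[OF B(1)]
    measurable_proj[OF A(1), unfolded A(3)] measurable_transverse_gaussian[OF A(1), unfolded weight_fiber[OF P]]
    measurable_transverse_gaussian[OF subspace_orthogonal_comp, of "P + Q", unfolded weight_perp[OF P Q]]
    measurable_proj[OF subspace_orthogonal_comp, of "P + Q"]
  have [measurable]: "proj_perp Q P \<in> borel_measurable borel"
    using measurable_proj[OF P'(1)] measurable_proj[OF Q'(1)] unfolding proj_perp_def[abs_def] by measurable
  have AB: "?A \<subseteq> ?B\<^sup>\<bottom>" and QB: "Q \<subseteq> ?B\<^sup>\<bottom>"
    by (auto simp: orth_comp_iff) (metis inner_commute)+
  have proj_v: "proj \<eta> v = 0"
    using v by (intro proj_eq_0 \<eta>) (auto simp: orth_comp_iff)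
  then have proj_B_v: "proj ?B v = v - proj Q v"
    by (simp add: B(3))
  interpret A: sigma_finite_measure "subspace_lborel ?A"
    by (rule sigma_finite_subspace_lborel[OF A(1)])
  interpret BA: sigma_finite_measure "subspace_lborel ((P + Q)\<^sup>\<bottom>)"
    by (rule sigma_finite_subspace_lborel[OF subspace_orthogonal_comp])
  let ?k = "\<lambda>d x. ennreal (riesz_kernel d \<alpha> x)"
  have "(\<integral>\<^sup>+u. (\<integral>\<^sup>+w. ?k (l + m) (u + (v - proj Q v) - w) * G w \<partial>subspace_lborel ((P + Q)\<^sup>\<bottom>)) \<partial>subspace_lborel ?A)
      = (\<integral>\<^sup>+x. ennreal (weight_fiber P x) * (\<integral>\<^sup>+w. ?k (l + m) (proj_fiber P x + (v - proj Q v) - w) * G w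
           \<partial>subspace_lborel ((P + Q)\<^sup>\<bottom>)) \<partial>lborel)"
    by (subst nn_integral_subspace_lborel[OF A(1)]) (simp_all add: weight_fiber[OF P] A(3))
  also have "\<dots> = (\<integral>\<^sup>+x. ennreal (weight_fiber P x) * (\<integral>\<^sup>+y. ennreal (weight_perp Q P y) *
      (?k (l + m) (proj_fiber P x + (v - proj Q v) - proj_perp Q P y) * G (proj_perp Q P y)) \<partial>lborel) \<partial>lborel)"
    by (subst nn_integral_subspace_lborel[OF subspace_orthogonal_comp])
       (simp_all add: weight_perp[OF P Q] PQ(4))
  also have "\<dots> = (\<integral>\<^sup>+x. \<integral>\<^sup>+y. ennreal (kernel_L (Q, P, x, y)) * G (proj_perp Q P y) \<partial>lborel \<partial>lborel)"
    using \<alpha> by (simp add: nn_integral_cmult[symmetric] kernel_L_def ennreal_mult'' ennreal_mult' weight_nonneg riesz_kernel_nonneg mult.assoc)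
  finally have L: "(\<integral>\<^sup>+u. (\<integral>\<^sup>+w. ?k (l + m) (u + (v - proj Q v) - w) * G w
        \<partial>subspace_lborel ((P + Q)\<^sup>\<bottom>)) \<partial>subspace_lborel ?A)
      = (\<integral>\<^sup>+x. \<integral>\<^sup>+y. ennreal (kernel_L (Q, P, x, y)) * G (proj_perp Q P y) \<partial>lborel \<partial>lborel)" .

  have proj_B: "proj ?B (proj_\<eta>_perp y) = proj_\<eta>_perp y - proj Q y" for y
  proof -
    have "proj \<eta> (proj_\<eta>_perp y) = 0"
      using proj_in[OF \<eta>_perp(1), of y]
      by (intro proj_eq_0 \<eta>) (auto simp: orth_comp_iff proj_\<eta>_perp[symmetric])
    moreover have "proj Q (proj \<eta> y) = 0"
      using proj_in[OF \<eta>(1), of y] Q'(2) by (intro proj_eq_0 Q'(1)) (auto simp: orth_comp_iff inner_commute)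
    ultimately show ?thesis
      by (simp add: B(3) proj_\<eta>_perp_def[of y] linear_diff[OF linear_proj[OF Q'(1)]])
  qed
  have "(\<integral>\<^sup>+w. ?k (q + m) (v - w) * (\<integral>\<^sup>+a. G (a + proj ?B w) \<partial>subspace_lborel ?A) \<partial>subspace_lborel (\<eta>\<^sup>\<bottom>))
      = (\<integral>\<^sup>+y. ennreal (weight_\<eta>_perp y) * (?k (q + m) (v - proj_\<eta>_perp y) *
          (\<integral>\<^sup>+a. G (a + (proj_\<eta>_perp y - proj Q y)) \<partial>subspace_lborel ?A)) \<partial>lborel)"
    by (subst nn_integral_subspace_lborel[OF \<eta>_perp(1)]) (simp_all add: weight_\<eta>_perp proj_\<eta>_perp proj_B)
  also have "\<dots> = (\<integral>\<^sup>+y. ennreal (weight_\<eta>_perp y) * (?k (q + m) (v - proj_\<eta>_perp y) *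
          (\<integral>\<^sup>+x. ennreal (weight_fiber P x) * G (proj_fiber P x + (proj_\<eta>_perp y - proj Q y)) \<partial>lborel)) \<partial>lborel)"
    by (subst nn_integral_subspace_lborel[OF A(1)]) (simp_all add: weight_fiber[OF P] A(3))
  also have "\<dots> = (\<integral>\<^sup>+y. \<integral>\<^sup>+x. ennreal (kernel_R (y, Q, P, x)) *
           G (proj_fiber P x + (proj_\<eta>_perp y - proj Q y)) \<partial>lborel \<partial>lborel)"
    using \<alpha> by (simp add: nn_integral_cmult[symmetric] kernel_R_def ennreal_mult'' ennreal_mult' weight_nonneg riesz_kernel_nonneg mult.assoc)
  finally have R: "(\<integral>\<^sup>+w. ?k (q + m) (v - w) * (\<integral>\<^sup>+a. G (a + proj ?B w) \<partial>subspace_lborel ?A) \<partial>subspace_lborel (\<eta>\<^sup>\<bottom>))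
      = (\<integral>\<^sup>+y. \<integral>\<^sup>+x. ennreal (kernel_R (y, Q, P, x)) *
           G (proj_fiber P x + (proj_\<eta>_perp y - proj Q y)) \<partial>lborel \<partial>lborel)" .

  have "(\<integral>\<^sup>+u. (\<integral>\<^sup>+w. ?k (dim ?A + dim ?B) (u + proj ?B v - w) * G w
            \<partial>subspace_lborel (?B + ?A)) \<partial>subspace_lborel ?A)
       = (\<integral>\<^sup>+w. ?k (dim Q + dim ?B) (v - w) *
            (\<integral>\<^sup>+a. G (a + proj ?B w) \<partial>subspace_lborel ?A) \<partial>subspace_lborel (?B + Q))"
    using \<alpha> v by (intro riesz_kernel_identity A(1) B(1) Q'(1) AB QB) (auto simp: B(2,4))
  then show ?thesis
    unfolding A(2) B(2,4) Q'(3) PQ(5)[symmetric] proj_B_v L R .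
qed

text \<open>
  Integrating f over planes with respect to these measures gives the two sides of the identity.
\<close>

definition "incidence_measure_L = distr (density ML (\<lambda>z. ennreal (kernel_L z))) MN param_L"
definition "incidence_measure_R = distr (density MR (\<lambda>z. ennreal (kernel_R z))) MN param_R"

lemma nn_integral_incidence_measure_L:
  assumes [measurable]: "G \<in> borel_measurable MN"
  shows "(\<integral>\<^sup>+z. G z \<partial>incidence_measure_L)
       = (\<integral>\<^sup>+Q. \<integral>\<^sup>+P. \<integral>\<^sup>+x. \<integral>\<^sup>+y. ennreal (kernel_L (Q, P, x, y)) * G (Q, P, proj_perp Q P y)
            \<partial>lborel \<partial>lborel \<partial>MP \<partial>MQ)"
proof -
  have "(\<integral>\<^sup>+z. G z \<partial>incidence_measure_L) = (\<integral>\<^sup>+z. ennreal (kernel_L z) * G (param_L z) \<partial>ML)"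
    unfolding incidence_measure_L_def
    by (subst nn_integral_distr, measurable, subst nn_integral_density) auto
  also have "\<dots> = (\<integral>\<^sup>+Q. \<integral>\<^sup>+P. \<integral>\<^sup>+x. \<integral>\<^sup>+y. ennreal (kernel_L (Q, P, x, y)) * G (param_L (Q, P, x, y))
            \<partial>lborel \<partial>lborel \<partial>MP \<partial>MQ)"
    by (rule nn_integral_iterated4[OF MP.sigma_finite_measure_axioms lborel.sigma_finite_measure_axioms
          lborel.sigma_finite_measure_axioms]) measurable
  finally show ?thesis by (simp add: param_L_def)
qed

lemma nn_integral_incidence_measure_R:
  assumes [measurable]: "G \<in> borel_measurable MN"
  shows "(\<integral>\<^sup>+z. G z \<partial>incidence_measure_R)
       = (\<integral>\<^sup>+y. \<integral>\<^sup>+Q. \<integral>\<^sup>+P. \<integral>\<^sup>+x. ennreal (kernel_R (y, Q, P, x)) *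
            G (Q, P, proj_fiber P x + (proj_\<eta>_perp y - proj Q y)) \<partial>lborel \<partial>MP \<partial>MQ \<partial>lborel)"
proof -
  have "(\<integral>\<^sup>+z. G z \<partial>incidence_measure_R) = (\<integral>\<^sup>+z. ennreal (kernel_R z) * G (param_R z) \<partial>MR)"
    unfolding incidence_measure_R_def
    by (subst nn_integral_distr, measurable, subst nn_integral_density) auto
  also have "\<dots> = (\<integral>\<^sup>+y. \<integral>\<^sup>+Q. \<integral>\<^sup>+P. \<integral>\<^sup>+x. ennreal (kernel_R (y, Q, P, x)) * G (param_R (y, Q, P, x))
            \<partial>lborel \<partial>MP \<partial>MQ \<partial>lborel)"
    by (rule nn_integral_iterated4[OF MQ.sigma_finite_measure_axioms MP.sigma_finite_measure_axioms
          lborel.sigma_finite_measure_axioms]) measurable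
  finally show ?thesis by (simp add: param_R_def)
qed

text \<open>
  Tonelli's theorem moves the integral over y inside the integrals over Q and P, and there the identity
for fixed directions applies.
\<close>

lemma incidence_measure_eq: "incidence_measure_L = incidence_measure_R"
proof (rule measure_eqI)
  show "sets incidence_measure_L = sets incidence_measure_R"
    by (simp add: incidence_measure_L_def incidence_measure_R_def)
  fix E assume "E \<in> sets incidence_measure_L"
  then have [measurable]: "E \<in> sets MN"
    by (simp add: incidence_measure_L_def)
  let ?G = "indicator E :: _ \<Rightarrow> ennreal"
  have [measurable]: "?G \<in> borel_measurable MN" by measurable
  interpret Q: pair_sigma_finite "lborel :: (real ^ 'n) measure" MQ ..
  interpret P: pair_sigma_finite "lborel :: (real ^ 'n) measure" MP ..
  have swap: "(\<integral>\<^sup>+y. \<integral>\<^sup>+P. \<integral>\<^sup>+x. ennreal (kernel_R (y, Q, P, x)) *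
            ?G (Q, P, proj_fiber P x + (proj_\<eta>_perp y - proj Q y)) \<partial>lborel \<partial>MP \<partial>lborel)
        = (\<integral>\<^sup>+P. \<integral>\<^sup>+y. \<integral>\<^sup>+x. ennreal (kernel_R (y, Q, P, x)) *
            ?G (Q, P, proj_fiber P x + (proj_\<eta>_perp y - proj Q y)) \<partial>lborel \<partial>lborel \<partial>MP)"
    if Q[measurable]: "Q \<in> space MQ" for Q
  proof -
    have [measurable]: "proj Q \<in> borel_measurable borel"
      using Q by (intro measurable_proj) (auto simp: space_MQ dest: grassmannianD)
    show ?thesis
      by (rule P.Fubini'[symmetric]) measurable
  qed
  have "emeasure incidence_measure_R E = (\<integral>\<^sup>+z. ?G z \<partial>incidence_measure_R)"
    by (simp add: incidence_measure_R_def)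
  also have "\<dots> = (\<integral>\<^sup>+y. \<integral>\<^sup>+Q. \<integral>\<^sup>+P. \<integral>\<^sup>+x. ennreal (kernel_R (y, Q, P, x)) *
            ?G (Q, P, proj_fiber P x + (proj_\<eta>_perp y - proj Q y)) \<partial>lborel \<partial>MP \<partial>MQ \<partial>lborel)"
    by (rule nn_integral_incidence_measure_R) measurable
  also have "\<dots> = (\<integral>\<^sup>+Q. \<integral>\<^sup>+y. \<integral>\<^sup>+P. \<integral>\<^sup>+x. ennreal (kernel_R (y, Q, P, x)) *
            ?G (Q, P, proj_fiber P x + (proj_\<eta>_perp y - proj Q y)) \<partial>lborel \<partial>MP \<partial>lborel \<partial>MQ)"
    by (intro Q.Fubini'[symmetric]) measurable
  also have "\<dots> = (\<integral>\<^sup>+Q. \<integral>\<^sup>+P. \<integral>\<^sup>+y. \<integral>\<^sup>+x. ennreal (kernel_R (y, Q, P, x)) *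
            ?G (Q, P, proj_fiber P x + (proj_\<eta>_perp y - proj Q y)) \<partial>lborel \<partial>lborel \<partial>MP \<partial>MQ)"
    by (intro nn_integral_cong swap)
  also have "\<dots> = (\<integral>\<^sup>+Q. \<integral>\<^sup>+P. \<integral>\<^sup>+x. \<integral>\<^sup>+y. ennreal (kernel_L (Q, P, x, y)) * ?G (Q, P, proj_perp Q P y)
            \<partial>lborel \<partial>lborel \<partial>MP \<partial>MQ)"
  proof (intro nn_integral_cong[of MQ] nn_integral_cong[of MP] nn_integral_fixed_directions[symmetric])
    fix Q P assume [measurable]: "Q \<in> space MQ" "P \<in> space MP"
    then show "P \<in> grassmannian p \<eta>" "Q \<in> grassmannian q (\<eta>\<^sup>\<bottom>)"
      by (auto simp: space_MP space_MQ)
    show "(\<lambda>z. ?G (Q, P, z)) \<in> borel_measurable borel"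
      by measurable
  qed
  also have "\<dots> = (\<integral>\<^sup>+z. ?G z \<partial>incidence_measure_L)"
    by (rule nn_integral_incidence_measure_L[symmetric]) measurable
  also have "\<dots> = emeasure incidence_measure_L E"
    by (simp add: incidence_measure_L_def)
  finally show "emeasure incidence_measure_L E = emeasure incidence_measure_R E" ..
qed

lemma integral_incidence_measure_L:
  fixes G :: "_ \<Rightarrow> 'b::{banach, second_countable_topology}"
  assumes G: "integrable incidence_measure_L G"
  shows "(LINT z|incidence_measure_L. G z)
       = (LINT Q|MQ. LINT P|MP. LINT x|lborel. LINT y|lborel.
            kernel_L (Q, P, x, y) *\<^sub>R G (Q, P, proj_perp Q P y))"
proof -
  have [measurable]: "G \<in> borel_measurable MN"
    using borel_measurable_integrable[OF G] by (simp add: incidence_measure_L_def)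
  have "integrable (density ML (\<lambda>z. ennreal (kernel_L z))) (\<lambda>z. G (param_L z))"
    using G unfolding incidence_measure_L_def by (subst (asm) integrable_distr_eq) auto
  then have int: "integrable ML (\<lambda>z. kernel_L z *\<^sub>R G (param_L z))"
    by (subst (asm) integrable_density) (auto simp: kernel_nonneg)
  have "(LINT z|incidence_measure_L. G z) = (LINT z|ML. kernel_L z *\<^sub>R G (param_L z))"
    unfolding incidence_measure_L_def
    by (subst integral_distr, measurable, subst integral_density) (auto simp: kernel_nonneg)
  also have "\<dots> = (LINT Q|MQ. LINT P|MP. LINT x|lborel. LINT y|lborel.
      kernel_L (Q, P, x, y) *\<^sub>R G (param_L (Q, P, x, y)))"
    by (rule integral_iterated4[OF MQ.sigma_finite_measure_axioms MP.sigma_finite_measure_axioms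
          lborel.sigma_finite_measure_axioms lborel.sigma_finite_measure_axioms int])
  finally show ?thesis by (simp add: param_L_def)
qed

lemma integral_incidence_measure_R:
  fixes G :: "_ \<Rightarrow> 'b::{banach, second_countable_topology}"
  assumes G: "integrable incidence_measure_R G"
  shows "(LINT z|incidence_measure_R. G z)
       = (LINT y|lborel. LINT Q|MQ. LINT P|MP. LINT x|lborel.
            kernel_R (y, Q, P, x) *\<^sub>R G (Q, P, proj_fiber P x + (proj_\<eta>_perp y - proj Q y)))"
proof -
  have [measurable]: "G \<in> borel_measurable MN"
    using borel_measurable_integrable[OF G] by (simp add: incidence_measure_R_def)
  have "integrable (density MR (\<lambda>z. ennreal (kernel_R z))) (\<lambda>z. G (param_R z))"
    using G unfolding incidence_measure_R_def by (subst (asm) integrable_distr_eq) auto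
  then have int: "integrable MR (\<lambda>z. kernel_R z *\<^sub>R G (param_R z))"
    by (subst (asm) integrable_density) (auto simp: kernel_nonneg)
  have "(LINT z|incidence_measure_R. G z) = (LINT z|MR. kernel_R z *\<^sub>R G (param_R z))"
    unfolding incidence_measure_R_def
    by (subst integral_distr, measurable, subst integral_density) (auto simp: kernel_nonneg)
  also have "\<dots> = (LINT y|lborel. LINT Q|MQ. LINT P|MP. LINT x|lborel.
      kernel_R (y, Q, P, x) *\<^sub>R G (param_R (y, Q, P, x)))"
    by (rule integral_iterated4[OF lborel.sigma_finite_measure_axioms MQ.sigma_finite_measure_axioms
          MP.sigma_finite_measure_axioms lborel.sigma_finite_measure_axioms int])
  finally show ?thesis by (simp add: param_R_def)
qed

section \<open>Both sides as integrals over planes\<close>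

definition "plane_of = (\<lambda>(Q, P, z :: real ^ 'n). (+) z ` (P + Q))"

lemma measurable_plane_of[measurable]:
  "plane_of \<in> measurable MN (affine_grassmannian_borel (p + q))"
proof -
  let ?\<xi> = "\<lambda>(Q, P, z :: real ^ 'n). P + Q"
  let ?x = "\<lambda>(Q, P, z :: real ^ 'n). z"
  have space: "fst (snd z) \<in> grassmannian p \<eta>" "fst z \<in> grassmannian q (\<eta>\<^sup>\<bottom>)"
    if "z \<in> space MN" for z
    using that by (auto simp: space_pair_measure space_MP space_MQ)
  have proj: "proj (?\<xi> z) x = proj (fst (snd z)) x + proj (fst z) x" if "z \<in> space MN" for z x
    using sum_direction(3)[OF space[OF that]] by (simp add: split_beta)
  have "(\<lambda>z. (+) (?x z) ` ?\<xi> z) \<in> measurable MN (affine_grassmannian_borel (p + q))"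
  proof (rule measurable_affine_grassmannian_borelI)
    show "subspace (?\<xi> z) \<and> dim (?\<xi> z) = p + q" if "z \<in> space MN" for z
      using sum_direction(1,2)[OF space[OF that]] by (simp add: split_beta)
    have "(\<lambda>z. proj (fst (snd z)) x + proj (fst z) x) \<in> borel_measurable MN" for x
      by measurable
    also have "?this x \<longleftrightarrow> (\<lambda>z. proj (?\<xi> z) x) \<in> borel_measurable MN" for x
      by (intro measurable_cong) (simp add: proj)
    finally show "(\<lambda>z. proj (?\<xi> z) x) \<in> borel_measurable MN" for x .
    have "(\<lambda>z. ?x z - (proj (fst (snd z)) (?x z) + proj (fst z) (?x z))) \<in> borel_measurable MN"
      by measurable
    also have "?this \<longleftrightarrow> (\<lambda>z. ?x z - proj (?\<xi> z) (?x z)) \<in> borel_measurable MN"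
      by (intro measurable_cong) (simp add: proj)
    finally show "(\<lambda>z. ?x z - proj (?\<xi> z) (?x z)) \<in> borel_measurable MN" .
  qed
  then show ?thesis
    by (simp add: plane_of_def split_beta)
qed

lemma measurable_fixed_plane:
  assumes \<phi>: "\<phi> \<in> measurable (affine_grassmannian_borel (p + q)) M"
    and PQ: "P \<in> grassmannian p \<eta>" "Q \<in> grassmannian q (\<eta>\<^sup>\<bottom>)"
  shows "(\<lambda>w. \<phi> ((+) w ` (P + Q))) \<in> measurable borel M"
  using measurable_compose[OF measurable_translate[OF sum_direction(1)[OF PQ]]] \<phi> sum_direction(2)[OF PQ]
  by simp

lemma proj_v: "proj \<eta> v = 0" "proj_\<eta>_perp v = v"
  using v proj_eq_0[OF \<eta>(1), of v] by (auto simp: orth_comp_iff proj_\<eta>_perp_def)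

text \<open>
  A point u + v with u in \<^term>\<open>P\<^sup>\<bottom> \<inter> \<eta>\<close> and v orthogonal to \<eta> has only its component along Q to lose.
\<close>

lemma foot_eq:
  assumes P: "P \<in> grassmannian p \<eta>" and Q: "Q \<in> grassmannian q (\<eta>\<^sup>\<bottom>)"
  shows "(proj_fiber P x + v) - proj (P + Q) (proj_fiber P x + v) = proj_fiber P x + (v - proj Q v)"
proof -
  note P' = grassmannianD[OF P] and Q' = grassmannianD[OF Q]
  have a: "proj_fiber P x \<in> P\<^sup>\<bottom>" "proj_fiber P x \<in> \<eta>"
    using proj_in[OF fiber_subspace(1)[OF P], of x] fiber_subspace(3)[OF P] by auto
  have "proj P (proj_fiber P x) = 0" "proj P v = 0" "proj Q (proj_fiber P x) = 0"
    using a v P'(2) Q'(2) by (auto intro!: proj_eq_0 P'(1) Q'(1) simp: orth_comp_iff subset_iff inner_commute)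
  then show ?thesis
    by (simp add: sum_direction(3)[OF P Q] linear_add[OF linear_proj] P'(1) Q'(1))
qed

text \<open>
  The plane is unchanged by moving its base point along Q, which yields the base point used in
\<open>param_R\<close>.
\<close>

lemma plane_of_shift:
  assumes P: "P \<in> grassmannian p \<eta>" and Q: "Q \<in> grassmannian q (\<eta>\<^sup>\<bottom>)"
  shows "(+) (a + b) ` (P + Q) = plane_of (Q, P, a + (b - proj Q y))"
proof -
  have "proj Q y \<in> P + Q"
    using proj_in[OF grassmannianD(1)[OF Q], of y] subspace_0[OF grassmannianD(1)[OF P]]
      set_plus_intro[of 0 P "proj Q y" Q] by simp
  then show ?thesis
    unfolding plane_of_def prod.case
    by (intro translate_subspace_eq sum_direction(1)[OF P Q]) simp
qed

lemma strichartz_riesz_nn: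
  assumes \<phi>[measurable]: "\<phi> \<in> borel_measurable (affine_grassmannian_borel (p + q))"
  shows "strichartz_transform_nn p q (riesz_potential_nn (l + m) \<alpha> \<phi>) ((+) v ` \<eta>)
       = (\<integral>\<^sup>+z. \<phi> (plane_of z) \<partial>incidence_measure_L)"
proof -
  have \<alpha>': "\<alpha> < real (l + m)"
    using \<alpha> by simp
  have "(\<integral>\<^sup>+u. riesz_potential_nn (l + m) \<alpha> \<phi> ((+) (u + (v - proj \<eta> v)) ` (P + Q)) \<partial>subspace_lborel (P\<^sup>\<bottom> \<inter> \<eta>))
      = (\<integral>\<^sup>+x. \<integral>\<^sup>+y. ennreal (kernel_L (Q, P, x, y)) * \<phi> (plane_of (Q, P, proj_perp Q P y)) \<partial>lborel \<partial>lborel)"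
    if "P \<in> space MP" "Q \<in> space MQ" for P Q
  proof -
    have P: "P \<in> grassmannian p \<eta>" and Q: "Q \<in> grassmannian q (\<eta>\<^sup>\<bottom>)"
      using that by (auto simp: space_MP space_MQ)
    note PQ = sum_direction[OF P Q] and A = fiber_subspace[OF P]
    note perp = subspace_orthogonal_comp[of "P + Q"]
    note [measurable] = measurable_fixed_plane[OF \<phi> P Q] measurable_proj[OF PQ(1)]
      measurable_proj[OF perp] measurable_transverse_gaussian[OF perp]
    have proj_perp: "proj ((P + Q)\<^sup>\<bottom>) = proj_perp Q P"
      by (simp add: PQ(4) fun_eq_iff)
    interpret perp: sigma_finite_measure "subspace_lborel ((P + Q)\<^sup>\<bottom>)"
      by (rule sigma_finite_subspace_lborel[OF perp])
    have "(\<integral>\<^sup>+u. riesz_potential_nn (l + m) \<alpha> \<phi> ((+) (u + (v - proj \<eta> v)) ` (P + Q)) \<partial>subspace_lborel (P\<^sup>\<bottom> \<inter> \<eta>))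
        = (\<integral>\<^sup>+u. \<integral>\<^sup>+w. ennreal (riesz_kernel (l + m) \<alpha> ((u + v) - proj (P + Q) (u + v) - w)) *
             \<phi> ((+) w ` (P + Q)) \<partial>subspace_lborel ((P + Q)\<^sup>\<bottom>) \<partial>subspace_lborel (P\<^sup>\<bottom> \<inter> \<eta>))"
      by (simp add: riesz_potential_nn_translate[OF PQ(1) \<alpha>(1) \<alpha>'] proj_v)
    also have "\<dots> = (\<integral>\<^sup>+x. ennreal (weight_fiber P x) *
        (\<integral>\<^sup>+w. ennreal (riesz_kernel (l + m) \<alpha> ((proj_fiber P x + v) - proj (P + Q) (proj_fiber P x + v) - w)) *
             \<phi> ((+) w ` (P + Q)) \<partial>subspace_lborel ((P + Q)\<^sup>\<bottom>)) \<partial>lborel)"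
      by (subst nn_integral_subspace_lborel[OF A(1)]) (simp_all add: weight_fiber[OF P] A(3))
    also have "\<dots> = (\<integral>\<^sup>+x. ennreal (weight_fiber P x) *
        (\<integral>\<^sup>+y. ennreal (weight_perp Q P y) *
          (ennreal (riesz_kernel (l + m) \<alpha> (proj_fiber P x + (v - proj Q v) - proj_perp Q P y)) *
             \<phi> (plane_of (Q, P, proj_perp Q P y))) \<partial>lborel) \<partial>lborel)"
      by (subst nn_integral_subspace_lborel[OF perp])
         (simp_all add: weight_perp[OF P Q] proj_perp foot_eq[OF P Q] plane_of_def)
    also have "\<dots> = (\<integral>\<^sup>+x. \<integral>\<^sup>+y. ennreal (kernel_L (Q, P, x, y)) *
        \<phi> (plane_of (Q, P, proj_perp Q P y)) \<partial>lborel \<partial>lborel)"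
    proof -
      have [measurable]: "proj_perp Q P \<in> borel_measurable borel" "weight_perp Q P \<in> borel_measurable borel"
        using measurable_proj[OF perp] measurable_transverse_gaussian[OF perp]
        by (simp_all add: proj_perp weight_perp[OF P Q])
      have "(\<lambda>y. \<phi> (plane_of (Q, P, proj_perp Q P y))) \<in> borel_measurable borel"
        unfolding plane_of_def prod.case by measurable
      then show ?thesis
        using \<alpha> by (simp add: nn_integral_cmult[symmetric] kernel_L_def ennreal_mult'' ennreal_mult'
            weight_nonneg riesz_kernel_nonneg mult.assoc)
    qed
    finally show ?thesis .
  qed
  then show ?thesis
    unfolding strichartz_transform_nn_translate[OF \<eta>(1)]
    by (subst nn_integral_incidence_measure_L) (auto intro!: nn_integral_cong)
qed

lemma strichartz_riesz:
  fixes \<phi> :: "(real ^ 'n) set \<Rightarrow> 'b::{banach, second_countable_topology}"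
  assumes \<phi>[measurable]: "\<phi> \<in> borel_measurable (affine_grassmannian_borel (p + q))"
    and int: "integrable incidence_measure_L (\<lambda>z. \<phi> (plane_of z))"
  shows "strichartz_transform p q (riesz_potential (l + m) \<alpha> \<phi>) ((+) v ` \<eta>)
       = (LINT z|incidence_measure_L. \<phi> (plane_of z))"
proof -
  have "(LINT u|subspace_lborel (P\<^sup>\<bottom> \<inter> \<eta>). riesz_potential (l + m) \<alpha> \<phi> ((+) (u + (v - proj \<eta> v)) ` (P + Q)))
      = (LINT x|lborel. LINT y|lborel. kernel_L (Q, P, x, y) *\<^sub>R \<phi> (plane_of (Q, P, proj_perp Q P y)))"
    if "P \<in> space MP" "Q \<in> space MQ" for P Q
  proof -
    have P: "P \<in> grassmannian p \<eta>" and Q: "Q \<in> grassmannian q (\<eta>\<^sup>\<bottom>)"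
      using that by (auto simp: space_MP space_MQ)
    note PQ = sum_direction[OF P Q] and A = fiber_subspace[OF P]
    note perp = subspace_orthogonal_comp[of "P + Q"]
    note [measurable] = measurable_fixed_plane[OF \<phi> P Q] measurable_proj[OF PQ(1)]
    have proj_perp: "proj ((P + Q)\<^sup>\<bottom>) = proj_perp Q P"
      by (simp add: PQ(4) fun_eq_iff)
    interpret perp: sigma_finite_measure "subspace_lborel ((P + Q)\<^sup>\<bottom>)"
      by (rule sigma_finite_subspace_lborel[OF perp])
    have "(LINT u|subspace_lborel (P\<^sup>\<bottom> \<inter> \<eta>). riesz_potential (l + m) \<alpha> \<phi> ((+) (u + (v - proj \<eta> v)) ` (P + Q)))
        = (LINT u|subspace_lborel (P\<^sup>\<bottom> \<inter> \<eta>). LINT w|subspace_lborel ((P + Q)\<^sup>\<bottom>).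
             riesz_kernel (l + m) \<alpha> ((u + v) - proj (P + Q) (u + v) - w) *\<^sub>R \<phi> ((+) w ` (P + Q)))"
      by (simp add: riesz_potential_translate[OF PQ(1)] proj_v)
    also have "\<dots> = (LINT x|lborel. weight_fiber P x *\<^sub>R
        (LINT w|subspace_lborel ((P + Q)\<^sup>\<bottom>).
             riesz_kernel (l + m) \<alpha> ((proj_fiber P x + v) - proj (P + Q) (proj_fiber P x + v) - w) *\<^sub>R \<phi> ((+) w ` (P + Q))))"
      by (subst integral_subspace_lborel[OF A(1)]) (simp_all add: weight_fiber[OF P] A(3))
    also have "\<dots> = (LINT x|lborel. weight_fiber P x *\<^sub>R (LINT y|lborel. weight_perp Q P y *\<^sub>R
          (riesz_kernel (l + m) \<alpha> (proj_fiber P x + (v - proj Q v) - proj_perp Q P y) *\<^sub>R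
             \<phi> (plane_of (Q, P, proj_perp Q P y)))))"
      by (subst integral_subspace_lborel[OF perp])
         (simp_all add: weight_perp[OF P Q] proj_perp foot_eq[OF P Q] plane_of_def)
    finally show ?thesis
      by (simp add: integral_scaleR_right[symmetric] kernel_L_def mult.assoc)
  qed
  then show ?thesis
    unfolding strichartz_transform_translate[OF \<eta>(1)] integral_incidence_measure_L[OF int]
    by (intro Bochner_Integration.integral_cong[OF refl, of MQ] Bochner_Integration.integral_cong[OF refl, of MP])
qed

lemma strichartz_transform_nn_eq:
  assumes \<phi>[measurable]: "\<phi> \<in> borel_measurable (affine_grassmannian_borel (p + q))"
  shows "strichartz_transform_nn p q \<phi> ((+) w ` \<eta>)
       = (\<integral>\<^sup>+Q. \<integral>\<^sup>+P. \<integral>\<^sup>+x. ennreal (weight_fiber P x) *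
            \<phi> (plane_of (Q, P, proj_fiber P x + (proj_\<eta>_perp w - proj Q w))) \<partial>lborel \<partial>MP \<partial>MQ)"
  unfolding strichartz_transform_nn_translate[OF \<eta>(1)] proj_\<eta>_perp_def[symmetric]
proof (intro nn_integral_cong)
  fix P Q assume [measurable]: "Q \<in> space MQ" "P \<in> space MP"
  then have P: "P \<in> grassmannian p \<eta>" and Q: "Q \<in> grassmannian q (\<eta>\<^sup>\<bottom>)"
    by (auto simp: space_MP space_MQ)
  note [measurable] = measurable_fixed_plane[OF \<phi> P Q]
  show "(\<integral>\<^sup>+u. \<phi> ((+) (u + proj_\<eta>_perp w) ` (P + Q)) \<partial>subspace_lborel (P\<^sup>\<bottom> \<inter> \<eta>))
      = (\<integral>\<^sup>+x. ennreal (weight_fiber P x) * \<phi> (plane_of (Q, P, proj_fiber P x + (proj_\<eta>_perp w - proj Q w))) \<partial>lborel)"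
    by (subst nn_integral_subspace_lborel[OF fiber_subspace(1)[OF P]])
       (simp_all add: weight_fiber[OF P] fiber_subspace(3)[OF P] plane_of_shift[OF P Q, of _ _ w])
qed

lemma strichartz_transform_eq:
  fixes \<phi> :: "(real ^ 'n) set \<Rightarrow> 'b::{banach, second_countable_topology}"
  assumes \<phi>[measurable]: "\<phi> \<in> borel_measurable (affine_grassmannian_borel (p + q))"
  shows "strichartz_transform p q \<phi> ((+) w ` \<eta>)
       = (LINT Q|MQ. LINT P|MP. LINT x|lborel. weight_fiber P x *\<^sub>R
            \<phi> (plane_of (Q, P, proj_fiber P x + (proj_\<eta>_perp w - proj Q w))))"
  unfolding strichartz_transform_translate[OF \<eta>(1)] proj_\<eta>_perp_def[symmetric]
proof (intro Bochner_Integration.integral_cong[OF refl, of MQ] Bochner_Integration.integral_cong[OF refl, of MP])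
  fix P Q assume [measurable]: "Q \<in> space MQ" "P \<in> space MP"
  then have P: "P \<in> grassmannian p \<eta>" and Q: "Q \<in> grassmannian q (\<eta>\<^sup>\<bottom>)"
    by (auto simp: space_MP space_MQ)
  note [measurable] = measurable_fixed_plane[OF \<phi> P Q]
  show "(LINT u|subspace_lborel (P\<^sup>\<bottom> \<inter> \<eta>). \<phi> ((+) (u + proj_\<eta>_perp w) ` (P + Q)))
      = (LINT x|lborel. weight_fiber P x *\<^sub>R \<phi> (plane_of (Q, P, proj_fiber P x + (proj_\<eta>_perp w - proj Q w))))"
    by (subst integral_subspace_lborel[OF fiber_subspace(1)[OF P]])
       (simp_all add: weight_fiber[OF P] fiber_subspace(3)[OF P] plane_of_shift[OF P Q, of _ _ w])
qed

lemma measurable_fixed_translate[measurable]: "(\<lambda>w. (+) w ` \<eta>) \<in> measurable borel (affine_grassmannian_borel (p + l))"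
  using measurable_translate[OF \<eta>(1)] \<eta>(2) by simp

lemma riesz_strichartz_nn:
  assumes \<phi>[measurable]: "\<phi> \<in> borel_measurable (affine_grassmannian_borel (p + q))"
  shows "riesz_potential_nn (q + m) \<alpha> (strichartz_transform_nn p q \<phi>) ((+) v ` \<eta>)
       = (\<integral>\<^sup>+z. \<phi> (plane_of z) \<partial>incidence_measure_R)"
proof -
  have \<alpha>': "\<alpha> < real (q + m)"
    using \<alpha> by simp
  let ?S = "\<lambda>w. \<integral>\<^sup>+Q. \<integral>\<^sup>+P. \<integral>\<^sup>+x. ennreal (weight_fiber P x) *
      \<phi> (plane_of (Q, P, proj_fiber P x + (proj_\<eta>_perp w - proj Q w))) \<partial>lborel \<partial>MP \<partial>MQ"
  have S: "strichartz_transform_nn p q \<phi> ((+) w ` \<eta>) = ?S w" for w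
    by (rule strichartz_transform_nn_eq[OF \<phi>])
  \<comment> \<open>The transform depends on the plane only, and a point and its projection define the same translate.\<close>
  have S_idem: "?S (proj_\<eta>_perp y) = ?S y" for y
  proof -
    have "(+) (proj_\<eta>_perp y) ` \<eta> = (+) y ` \<eta>"
      using proj_in[OF \<eta>(1), of y]
      by (intro translate_subspace_eq[OF \<eta>(1)]) (simp add: proj_\<eta>_perp_def subspace_neg[OF \<eta>(1)])
    then show ?thesis by (simp only: S[symmetric])
  qed
  have [measurable]: "?S \<in> borel_measurable borel"
    by measurable
  have "riesz_potential_nn (q + m) \<alpha> (strichartz_transform_nn p q \<phi>) ((+) v ` \<eta>)
      = (\<integral>\<^sup>+w. ennreal (riesz_kernel (q + m) \<alpha> (v - w)) * ?S w \<partial>subspace_lborel (\<eta>\<^sup>\<bottom>))"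
    by (subst riesz_potential_nn_translate[OF \<eta>(1) \<alpha>(1) \<alpha>']) (simp_all add: S proj_v)
  also have "\<dots> = (\<integral>\<^sup>+y. ennreal (weight_\<eta>_perp y) *
      (ennreal (riesz_kernel (q + m) \<alpha> (v - proj_\<eta>_perp y)) * ?S (proj_\<eta>_perp y)) \<partial>lborel)"
    by (subst nn_integral_subspace_lborel[OF \<eta>_perp(1)], measurable) (simp only: weight_\<eta>_perp proj_\<eta>_perp)
  also have "\<dots> = (\<integral>\<^sup>+y. \<integral>\<^sup>+Q. \<integral>\<^sup>+P. \<integral>\<^sup>+x. ennreal (kernel_R (y, Q, P, x)) *
      \<phi> (plane_of (Q, P, proj_fiber P x + (proj_\<eta>_perp y - proj Q y))) \<partial>lborel \<partial>MP \<partial>MQ \<partial>lborel)"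
  proof (rule nn_integral_cong)
    fix y
    let ?c = "weight_\<eta>_perp y * riesz_kernel (q + m) \<alpha> (v - proj_\<eta>_perp y)"
    have c: "?c \<ge> 0"
      using \<alpha> weight_nonneg by (intro mult_nonneg_nonneg riesz_kernel_nonneg) auto
    have "ennreal (weight_\<eta>_perp y) * (ennreal (riesz_kernel (q + m) \<alpha> (v - proj_\<eta>_perp y)) * ?S (proj_\<eta>_perp y))
        = ennreal ?c * ?S y"
      unfolding S_idem using weight_nonneg by (simp add: mult.assoc ennreal_mult')
    also have "\<dots> = (\<integral>\<^sup>+Q. ennreal ?c * (\<integral>\<^sup>+P. \<integral>\<^sup>+x. ennreal (weight_fiber P x) *
        \<phi> (plane_of (Q, P, proj_fiber P x + (proj_\<eta>_perp y - proj Q y))) \<partial>lborel \<partial>MP) \<partial>MQ)"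
      by (rule nn_integral_cmult[symmetric]) measurable
    also have "\<dots> = (\<integral>\<^sup>+Q. \<integral>\<^sup>+P. ennreal ?c * (\<integral>\<^sup>+x. ennreal (weight_fiber P x) *
        \<phi> (plane_of (Q, P, proj_fiber P x + (proj_\<eta>_perp y - proj Q y))) \<partial>lborel) \<partial>MP \<partial>MQ)"
      by (intro nn_integral_cong nn_integral_cmult[symmetric]) measurable
    also have "\<dots> = (\<integral>\<^sup>+Q. \<integral>\<^sup>+P. \<integral>\<^sup>+x. ennreal ?c * (ennreal (weight_fiber P x) *
        \<phi> (plane_of (Q, P, proj_fiber P x + (proj_\<eta>_perp y - proj Q y)))) \<partial>lborel \<partial>MP \<partial>MQ)"
    proof (intro nn_integral_cong nn_integral_cmult[symmetric])
      fix Q P assume PQ[measurable]: "Q \<in> space MQ" "P \<in> space MP"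
      have [measurable]: "proj_fiber P \<in> borel_measurable borel" "weight_fiber P \<in> borel_measurable borel"
        using PQ(2) fiber_subspace[of P] measurable_proj[of "P\<^sup>\<bottom> \<inter> \<eta>"] measurable_transverse_gaussian[of "P\<^sup>\<bottom> \<inter> \<eta>"]
        by (simp_all add: space_MP weight_fiber)
      show "(\<lambda>x. ennreal (weight_fiber P x) *
          \<phi> (plane_of (Q, P, proj_fiber P x + (proj_\<eta>_perp y - proj Q y)))) \<in> borel_measurable lborel"
        by measurable
    qed
    also have "\<dots> = (\<integral>\<^sup>+Q. \<integral>\<^sup>+P. \<integral>\<^sup>+x. ennreal (kernel_R (y, Q, P, x)) *
        \<phi> (plane_of (Q, P, proj_fiber P x + (proj_\<eta>_perp y - proj Q y))) \<partial>lborel \<partial>MP \<partial>MQ)"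
      unfolding kernel_R_def prod.case mult.assoc[symmetric]
      using c weight_nonneg by (intro nn_integral_cong) (simp add: ennreal_mult)
    finally show "ennreal (weight_\<eta>_perp y) * (ennreal (riesz_kernel (q + m) \<alpha> (v - proj_\<eta>_perp y)) * ?S (proj_\<eta>_perp y))
        = (\<integral>\<^sup>+Q. \<integral>\<^sup>+P. \<integral>\<^sup>+x. ennreal (kernel_R (y, Q, P, x)) *
        \<phi> (plane_of (Q, P, proj_fiber P x + (proj_\<eta>_perp y - proj Q y))) \<partial>lborel \<partial>MP \<partial>MQ)" .
  qed
  also have "\<dots> = (\<integral>\<^sup>+z. \<phi> (plane_of z) \<partial>incidence_measure_R)"
    by (rule nn_integral_incidence_measure_R[symmetric]) measurable
  finally show ?thesis .
qed

lemma riesz_strichartz: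
  fixes \<phi> :: "(real ^ 'n) set \<Rightarrow> 'b::{banach, second_countable_topology}"
  assumes \<phi>[measurable]: "\<phi> \<in> borel_measurable (affine_grassmannian_borel (p + q))"
    and int: "integrable incidence_measure_R (\<lambda>z. \<phi> (plane_of z))"
  shows "riesz_potential (q + m) \<alpha> (strichartz_transform p q \<phi>) ((+) v ` \<eta>)
       = (LINT z|incidence_measure_R. \<phi> (plane_of z))"
proof -
  let ?S = "\<lambda>w. LINT Q|MQ. LINT P|MP. LINT x|lborel. weight_fiber P x *\<^sub>R
      \<phi> (plane_of (Q, P, proj_fiber P x + (proj_\<eta>_perp w - proj Q w)))"
  have S: "strichartz_transform p q \<phi> ((+) w ` \<eta>) = ?S w" for w
    by (rule strichartz_transform_eq[OF \<phi>])
  have S_idem: "?S (proj_\<eta>_perp y) = ?S y" for y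
  proof -
    have "(+) (proj_\<eta>_perp y) ` \<eta> = (+) y ` \<eta>"
      using proj_in[OF \<eta>(1), of y]
      by (intro translate_subspace_eq[OF \<eta>(1)]) (simp add: proj_\<eta>_perp_def subspace_neg[OF \<eta>(1)])
    then show ?thesis by (simp only: S[symmetric])
  qed
  have [measurable]: "?S \<in> borel_measurable borel"
    by measurable
  have "riesz_potential (q + m) \<alpha> (strichartz_transform p q \<phi>) ((+) v ` \<eta>)
      = (LINT w|subspace_lborel (\<eta>\<^sup>\<bottom>). riesz_kernel (q + m) \<alpha> (v - w) *\<^sub>R ?S w)"
    by (subst riesz_potential_translate[OF \<eta>(1)]) (simp add: S proj_v)
  also have "\<dots> = (LINT y|lborel. weight_\<eta>_perp y *\<^sub>R
      (riesz_kernel (q + m) \<alpha> (v - proj_\<eta>_perp y) *\<^sub>R ?S (proj_\<eta>_perp y)))"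
    by (subst integral_subspace_lborel[OF \<eta>_perp(1)], measurable) (simp only: weight_\<eta>_perp proj_\<eta>_perp)
  also have "\<dots> = (LINT y|lborel. LINT Q|MQ. LINT P|MP. LINT x|lborel. kernel_R (y, Q, P, x) *\<^sub>R
      \<phi> (plane_of (Q, P, proj_fiber P x + (proj_\<eta>_perp y - proj Q y))))"
    unfolding S_idem kernel_R_def prod.case scaleR_scaleR[symmetric] integral_scaleR_right ..
  also have "\<dots> = (LINT z|incidence_measure_R. \<phi> (plane_of z))"
    by (rule integral_incidence_measure_R[OF int, symmetric])
  finally show ?thesis .
qed

text \<open>
  For nonnegative functions the two sides are integrals with respect to equal measures.  Applied to the
norm of f this shows that f is integrable with respect to that measure as soon as one side converges
absolutely, and then the Bochner integrals are handled by Fubini's theorem.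
\<close>

theorem strichartz_riesz_commute:
  fixes f :: "(real ^ 'n) set \<Rightarrow> 'b::{banach, second_countable_topology}"
  assumes f[measurable]: "f \<in> borel_measurable (affine_grassmannian_borel (p + q))"
  defines "L \<equiv> strichartz_transform_nn p q (riesz_potential_nn (l + m) \<alpha> (\<lambda>A. ennreal (norm (f A)))) ((+) v ` \<eta>)"
    and "R \<equiv> riesz_potential_nn (q + m) \<alpha> (strichartz_transform_nn p q (\<lambda>A. ennreal (norm (f A)))) ((+) v ` \<eta>)"
  shows "L = R"
    and "L < \<infinity> \<Longrightarrow> strichartz_transform p q (riesz_potential (l + m) \<alpha> f) ((+) v ` \<eta>)
                = riesz_potential (q + m) \<alpha> (strichartz_transform p q f) ((+) v ` \<eta>)"
proof -
  have L: "L = (\<integral>\<^sup>+z. ennreal (norm (f (plane_of z))) \<partial>incidence_measure_L)"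
    unfolding L_def by (rule strichartz_riesz_nn) measurable
  show "L = R"
    unfolding L R_def incidence_measure_eq by (rule riesz_strichartz_nn[symmetric]) measurable
  assume "L < \<infinity>"
  then have int: "integrable incidence_measure_L (\<lambda>z. f (plane_of z))"
    unfolding L
    by (intro integrableI_bounded) (simp_all add: incidence_measure_L_def)
  show "strichartz_transform p q (riesz_potential (l + m) \<alpha> f) ((+) v ` \<eta>)
      = riesz_potential (q + m) \<alpha> (strichartz_transform p q f) ((+) v ` \<eta>)"
    using strichartz_riesz[OF f int] riesz_strichartz[OF f int[unfolded incidence_measure_eq]]
    by (simp add: incidence_measure_eq)
qed

end

theorem theorem5p1:
  fixes n p q l j k :: nat
    and \<alpha> :: real
    and f :: "(real ^ 'n) set \<Rightarrow> complex"
    and \<eta> :: "(real ^ 'n) set"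
    and v :: "real ^ 'n"
  assumes "n = CARD('n)"
    and "p > 0" and "q > 0" and "l > 0" and "p + q + l < n"
    and "j = p + q" and "k = p + l"
    and "0 < \<alpha>" and "\<alpha> < real n - real k - real q"
    and "f \<in> borel_measurable (affine_grassmannian_borel j)"
    and "\<eta> \<in> grassmannian k UNIV" and "v \<in> \<eta>\<^sup>\<bottom>"
    and "strichartz_transform_nn p q
           (riesz_potential_nn (n - j) \<alpha> (\<lambda>A. ennreal (norm (f A)))) ((+) v ` \<eta>) < \<infinity>
       \<or> riesz_potential_nn (n - k) \<alpha>
           (strichartz_transform_nn p q (\<lambda>A. ennreal (norm (f A)))) ((+) v ` \<eta>) < \<infinity>"
  shows "strichartz_transform_nn p q
           (riesz_potential_nn (n - j) \<alpha> (\<lambda>A. ennreal (norm (f A)))) ((+) v ` \<eta>) < \<infinity>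
       \<and> riesz_potential_nn (n - k) \<alpha>
           (strichartz_transform_nn p q (\<lambda>A. ennreal (norm (f A)))) ((+) v ` \<eta>) < \<infinity>
       \<and> strichartz_transform p q (riesz_potential (n - j) \<alpha> f) ((+) v ` \<eta>)
       = riesz_potential (n - k) \<alpha> (strichartz_transform p q f) ((+) v ` \<eta>)"
proof -
  \<comment> \<open>The subtraction does not truncate, since p + q + l < n.\<close>
  define m where "m = n - (p + l + q)"
  interpret strichartz_setting \<eta> v p q l m \<alpha>
    using assms by unfold_locales (auto simp: m_def)
  have codim: "n - j = l + m" "n - k = q + m"
    using assms by (auto simp: m_def)
  have f: "f \<in> borel_measurable (affine_grassmannian_borel (p + q))"
    using assms by simp
  show ?thesis
    using assms(13) strichartz_riesz_commute[OF f] unfolding codim by auto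
qed

end
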